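(* Let $l\in(-1/2,1/2)$ and let $H_{\pi/2}$ be the self-adjoint realization in $L^2(\mathbb{R}_+)$ of $-\frac{d^2}{dx^2}+\frac{l(l+1)}{x^2}$ defined in the context (the case $\alpha=\pi/2$, i.e. the boundary condition $\Gamma_1 f=0$). (i) If $l\in(-1/2,0]$, then $$\|e^{-\mathrm{i}tH_{\pi/2}}\|_{L^1(\mathbb{R}_+)\to L^\infty(\mathbb{R}_+)}=\mathcal{O}(|t|^{-1/2}),\qquad t\to\infty.$$ (ii) If $l\in(0,1/2)$, then $$\|e^{-\mathrm{i}tH_{\pi/2}}\|_{L^1(\mathbb{R}_+,\max(x^{-l},1))\to L^\infty(\mathbb{R}_+,\min(x^{l},1))}=\mathcal{O}(|t|^{-1/2+l}),\qquad t\to\infty,$$ and this last estimate is sharp, i.e. there are constants $c>0$ and $t_0>0$ such that the norm on the left-hand side is at least $c\,|t|^{-1/2+l}$ for all $t\ge t_0$.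
   Context: Let $l\in(-1/2,1/2)$, $\mathbb{R}_+=(0,\infty)$, and let $\tau=-\frac{d^2}{dx^2}+\frac{l(l+1)}{x^2}$. Let $H_{\max}$ be the maximal operator associated with $\tau$ in $L^2(\mathbb{R}_+)$: its domain consists of all $f\in L^2(\mathbb{R}_+)$ with $f,f'$ locally absolutely continuous on $(0,\infty)$ and $\tau f\in L^2(\mathbb{R}_+)$, and $H_{\max}f=\tau f$. Let $W_x(f,g)=f(x)g'(x)-f'(x)g(x)$ be the Wronskian. The limits $$\Gamma_0 f:=\lim_{x\to0}W_x(f,x^{l+1}),\qquad \Gamma_1 f:=\frac{-1}{2l+1}\lim_{x\to0}W_x(f,x^{-l})$$ exist and are finite for all $f\in\mathrm{dom}(H_{\max})$. For $\alpha\in[0,\pi)$, $H_\alpha$ denotes the self-adjoint restriction of $H_{\max}$ to $$\mathrm{dom}(H_\alpha)=\{f\in\mathrm{dom}(H_{\max}):\ \sin(\alpha)\,\Gamma_1 f=\cos(\alpha)\,\Gamma_0 f\}.$$ For a weight $w>0$ on $\mathbb{R}_+$, $L^1(\mathbb{R}_+,w)$ has norm $\int_0^\infty|f(x)|w(x)\,dx$ and $L^\infty(\mathbb{R}_+,w)$ has norm $\operatorname{ess\,sup}_{x>0}|f(x)|w(x)$; no weight means $w\equiv1$. For a bounded operator $T$ on $L^2(\mathbb{R}_+)$, $\|T\|_{X\to Y}$ denotes the supremum of $\|Tf\|_Y$ over all $f\in X\cap L^2(\mathbb{R}_+)$ with $\|f\|_X\le1$. *)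

theory Defs
  imports "HOL-Analysis.Analysis" "HOL-Probability.Essential_Supremum"
begin

section \<open>The space of square integrable functions on the half-line\<close>

text \<open>Elements of $L^2(0,\infty)$ are represented by Borel functions on the half-line; values on
  $(-\infty,0]$ are irrelevant, and equality in $L^2$ is equality almost everywhere.\<close>

definition half_line :: "real measure" where
  "half_line = restrict_space lborel {0<..}"

definition L2 :: "(real \<Rightarrow> complex) set" where
  "L2 = {f. f \<in> borel_measurable half_line \<and> integrable half_line (\<lambda>x. (cmod (f x))\<^sup>2)}"

definition L2norm :: "(real \<Rightarrow> complex) \<Rightarrow> real" where
  "L2norm f = sqrt (\<integral>x. (cmod (f x))\<^sup>2 \<partial>half_line)"

definition ae_eq :: "(real \<Rightarrow> complex) \<Rightarrow> (real \<Rightarrow> complex) \<Rightarrow> bool" where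
  "ae_eq f g \<longleftrightarrow> (AE x in half_line. f x = g x)"


section \<open>The differential expression and its realizations\<close>

text \<open>Absolute continuity in the usual epsilon-delta sense. The family \<open>\<D>\<close> ranges over the finite
  families of nonoverlapping compact subintervals \<open>K = {Inf K..Sup K}\<close> of \<open>{a..b}\<close>.\<close>

definition abs_continuous_on_interval :: "real \<Rightarrow> real \<Rightarrow> (real \<Rightarrow> complex) \<Rightarrow> bool" where
  "abs_continuous_on_interval a b f \<longleftrightarrow>
     (\<forall>\<epsilon>>0. \<exists>\<delta>>0. \<forall>\<D> S. \<D> division_of S \<longrightarrow> S \<subseteq> {a..b} \<longrightarrow>
        (\<Sum>K\<in>\<D>. Sup K - Inf K) < \<delta> \<longrightarrow> (\<Sum>K\<in>\<D>. cmod (f (Sup K) - f (Inf K))) < \<epsilon>)"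

definition locally_abs_continuous :: "(real \<Rightarrow> complex) \<Rightarrow> bool" where
  "locally_abs_continuous f \<longleftrightarrow> (\<forall>a b. 0 < a \<longrightarrow> a < b \<longrightarrow> abs_continuous_on_interval a b f)"

definition D :: "(real \<Rightarrow> complex) \<Rightarrow> real \<Rightarrow> complex" where
  "D f x = vector_derivative f (at x)"

text \<open>For \<open>f\<close> in the maximal domain below, \<open>D f\<close> is an everywhere defined derivative on
  $(0,\infty)$, whereas \<open>D (D f)\<close> is a genuine derivative only almost everywhere.\<close>

definition tau :: "real \<Rightarrow> (real \<Rightarrow> complex) \<Rightarrow> real \<Rightarrow> complex" where
  "tau l f x = - D (D f) x + complex_of_real (l * (l + 1) / x\<^sup>2) * f x"

definition dom_Hmax :: "real \<Rightarrow> (real \<Rightarrow> complex) set" where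
  "dom_Hmax l = {f \<in> L2. (\<forall>x>0. f differentiable (at x)) \<and>
      locally_abs_continuous f \<and> locally_abs_continuous (D f) \<and> tau l f \<in> L2}"

definition Wronskian :: "(real \<Rightarrow> complex) \<Rightarrow> (real \<Rightarrow> complex) \<Rightarrow> real \<Rightarrow> complex" where
  "Wronskian f g x = f x * D g x - D f x * g x"

definition Gamma0 :: "real \<Rightarrow> (real \<Rightarrow> complex) \<Rightarrow> complex" where
  "Gamma0 l f = Lim (at_right 0) (Wronskian f (\<lambda>x. complex_of_real (x powr (l + 1))))"

definition Gamma1 :: "real \<Rightarrow> (real \<Rightarrow> complex) \<Rightarrow> complex" where
  "Gamma1 l f = complex_of_real (- 1 / (2 * l + 1)) *
     Lim (at_right 0) (Wronskian f (\<lambda>x. complex_of_real (x powr (- l))))"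

definition dom_H :: "real \<Rightarrow> real \<Rightarrow> (real \<Rightarrow> complex) set" where
  "dom_H l \<alpha> = {f \<in> dom_Hmax l.
      complex_of_real (sin \<alpha>) * Gamma1 l f = complex_of_real (cos \<alpha>) * Gamma0 l f}"

text \<open>The graph of $H_\alpha$ as an operator in $L^2$, that is, closed under changing the function
  and its image on null sets.\<close>

definition H_graph :: "real \<Rightarrow> real \<Rightarrow> ((real \<Rightarrow> complex) \<times> (real \<Rightarrow> complex)) set" where
  "H_graph l \<alpha> = {(f, g). f \<in> L2 \<and> g \<in> L2 \<and> (\<exists>h \<in> dom_H l \<alpha>. ae_eq f h \<and> ae_eq g (tau l h))}"


section \<open>The unitary group generated by an operator\<close>

definition unitary_group :: "(real \<Rightarrow> (real \<Rightarrow> complex) \<Rightarrow> (real \<Rightarrow> complex)) \<Rightarrow> bool" where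
  "unitary_group U \<longleftrightarrow>
     (\<forall>t. \<forall>f\<in>L2. U t f \<in> L2) \<and>
     (\<forall>t. \<forall>f\<in>L2. \<forall>g\<in>L2. ae_eq f g \<longrightarrow> ae_eq (U t f) (U t g)) \<and>
     (\<forall>t. \<forall>f\<in>L2. \<forall>g\<in>L2. \<forall>a b.
        ae_eq (U t (\<lambda>x. a * f x + b * g x)) (\<lambda>x. a * U t f x + b * U t g x)) \<and>
     (\<forall>t. \<forall>f\<in>L2. L2norm (U t f) = L2norm f) \<and>
     (\<forall>f\<in>L2. ae_eq (U 0 f) f) \<and>
     (\<forall>s t. \<forall>f\<in>L2. ae_eq (U (s + t) f) (U s (U t f))) \<and>
     (\<forall>f\<in>L2. ((\<lambda>t. L2norm (\<lambda>x. U t f x - f x)) \<longlongrightarrow> 0) (at 0))"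

text \<open>\<open>is_exp_group A U\<close> says that \<open>U t\<close> is $e^{-\mathrm{i}tA}$ for all real \<open>t\<close>: \<open>U\<close> is a strongly
  continuous unitary group whose infinitesimal generator is exactly $-\mathrm{i}A$ (\<open>A\<close> being given
  by its graph). By Stone's theorem such a \<open>U\<close> exists for every self-adjoint \<open>A\<close>, and it is
  unique up to null sets.\<close>

definition is_exp_group ::
    "((real \<Rightarrow> complex) \<times> (real \<Rightarrow> complex)) set \<Rightarrow>
     (real \<Rightarrow> (real \<Rightarrow> complex) \<Rightarrow> (real \<Rightarrow> complex)) \<Rightarrow> bool" where
  "is_exp_group A U \<longleftrightarrow> unitary_group U \<and>
     (\<forall>f\<in>L2. \<forall>g\<in>L2. (f, g) \<in> A \<longleftrightarrow>
        ((\<lambda>t. L2norm (\<lambda>x. (U t f x - f x) / complex_of_real t - (- \<i> * g x))) \<longlongrightarrow> 0) (at 0))"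


section \<open>Norms between weighted spaces\<close>

definition L1norm :: "(real \<Rightarrow> real) \<Rightarrow> (real \<Rightarrow> complex) \<Rightarrow> ennreal" where
  "L1norm w f = (\<integral>\<^sup>+x. ennreal (cmod (f x) * w x) \<partial>half_line)"

definition Linfnorm :: "(real \<Rightarrow> real) \<Rightarrow> (real \<Rightarrow> complex) \<Rightarrow> ennreal" where
  "Linfnorm w f = esssup half_line (\<lambda>x. ennreal (cmod (f x) * w x))"

definition norm_L1_Linf ::
    "(real \<Rightarrow> real) \<Rightarrow> (real \<Rightarrow> real) \<Rightarrow> ((real \<Rightarrow> complex) \<Rightarrow> (real \<Rightarrow> complex)) \<Rightarrow> ennreal" where
  "norm_L1_Linf v w T = (SUP f \<in> {f \<in> L2. L1norm v f \<le> 1}. Linfnorm w (T f))"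

end

theory Submission
  imports Defs
begin

text \<open>The functions \<open>x\<^sup>-\<^sup>l z\<^sup>l\<^sup>-\<^sup>1\<^sup>/\<^sup>2 exp (- x\<^sup>2 / (4 z))\<close>, \<open>Re z > 0\<close>, lie in the domain of \<open>H\<close>, and \<open>H\<close> acts on
  them as \<open>- d/dz\<close>. Hence \<open>U t\<close> maps the Gaussian with parameter \<open>z\<close> to the one with parameter
  \<open>z + \<i> t\<close>, because a differentiable solution of the Schroedinger equation in \<open>L\<^sup>2\<close> is determined by
  its initial value. The Gaussian with \<open>z = 1\<close> already shows sharpness. For the upper bounds, fix \<open>t\<close>
  and consider combinations of \<open>x\<^sup>-\<^sup>l exp (- b x\<^sup>2 - \<i> x\<^sup>2 / (4 t))\<close> with \<open>b = 1, 2, \<dots>\<close>. At time \<open>t\<close> they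
  have become, up to a unimodular factor, real Gaussians, which a power series computation writes as
  integrals of the data against a multiple of \<open>(x y)\<^sup>1\<^sup>/\<^sup>2 J\<^sub>-\<^sub>(\<^sub>l\<^sub>+\<^sub>1\<^sub>/\<^sub>2\<^sub>) (x y / (2 t))\<close>. This kernel is bounded by an energy
  estimate for the Bessel equation, and the combinations are dense in \<open>L\<^sup>2\<close> and weighted \<open>L\<^sup>1\<close>
  simultaneously by the Weierstrass approximation theorem in the variable \<open>exp (- x\<^sup>2)\<close>.\<close>

section \<open>The Hilbert space and unitary groups\<close>

text \<open>\<open>U\<close> is given only through its generator, so every formula for it has to
  come from explicit orbits. Vertical lines in the half-plane Re z > 0 supply them, and the boundary
  condition \<open>Gamma1 l f = 0\<close> matches their behaviour x^(-l) at 0. The chirp exp(-i x^2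
  / (4 t)) is tuned to the one time t under study: the evolved datum is then real up to a phase, so
  the Bessel integral is needed only for real b, where it converges absolutely. The size of the
  kernel decides the two rates. It is a constant times t^(-1/2 + l) (x y)^(-l)
  \<open>bessel l z\<close> with z = x y / (2 t). At large z the bound O(z^l) turns (x y)^(-l) into
  t^(-l), which gives t^(-1/2). For l \<le> 0 the same bound holds down to z = 0. For l > 0 it fails
  there, because \<open>bessel l 0\<close> is not 0; the weights must absorb (x y)^(-l), and the
  factor t^(-1/2 + l) remains. Approximation in two norms at once is forced by the operator norm, a
  supremum over data in both spaces: L2 convergence lets \<open>U t\<close> pass to the limit, while
  weighted L1 convergence controls the right-hand side.\<close>

lemma space_half_line [simp]: "space half_line = {0<..}"
  by (simp add: half_line_def space_restrict_space)

lemma half_line_measurableI [measurable (raw)]: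
  "f \<in> borel_measurable borel \<Longrightarrow> f \<in> borel_measurable half_line"
  unfolding half_line_def by (intro measurable_restrict_space1) simp

lemma AE_half_lineI: "(\<And>x. x > 0 \<Longrightarrow> P x) \<Longrightarrow> AE x in half_line. P x"
  by (intro AE_I2) simp

lemma L2D: "f \<in> L2 \<Longrightarrow> f \<in> borel_measurable half_line"
  "f \<in> L2 \<Longrightarrow> integrable half_line (\<lambda>x. (cmod (f x))\<^sup>2)"
  by (simp_all add: L2_def)

text \<open>The free parameter \<open>s\<close> does the work of Cauchy-Schwarz:
  \<open>s = 1\<close> gives closure of \<open>L2\<close> under sums, and the ratio of two norms
  gives the triangle inequality.\<close>

lemma norm_add_sq_le:
  fixes a b :: "'a::real_normed_vector" and s :: real
  assumes "s > 0"
  shows "(norm (a + b))\<^sup>2 \<le> (1 + s) * (norm a)\<^sup>2 + (1 + 1 / s) * (norm b)\<^sup>2"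
proof -
  have "(norm (a + b))\<^sup>2 \<le> (norm a + norm b)\<^sup>2"
    by (intro power_mono norm_triangle_ineq) simp
  also have "\<dots> \<le> (1 + s) * (norm a)\<^sup>2 + (1 + 1 / s) * (norm b)\<^sup>2"
  proof -
    have "0 \<le> (s * norm a - norm b)\<^sup>2 / s" using assms by simp
    also have "\<dots> = s * (norm a)\<^sup>2 + (1 / s) * (norm b)\<^sup>2 - 2 * norm a * norm b"
      using assms by (simp add: field_simps power2_eq_square)
    finally show ?thesis by (simp add: power2_eq_square algebra_simps)
  qed
  finally show ?thesis .
qed

lemma L2_scale: "f \<in> L2 \<Longrightarrow> (\<lambda>x. c * f x) \<in> L2"
  by (auto simp: L2_def norm_mult power_mult_distrib)

lemma L2_add:
  assumes f: "f \<in> L2" and g: "g \<in> L2"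
  shows "(\<lambda>x. f x + g x) \<in> L2"
proof -
  note [measurable] = L2D(1)[OF f] L2D(1)[OF g]
  have "integrable half_line (\<lambda>x. (cmod (f x + g x))\<^sup>2)"
  proof (rule Bochner_Integration.integrable_bound)
    show "integrable half_line (\<lambda>x. (1 + 1) * (cmod (f x))\<^sup>2 + (1 + 1 / 1) * (cmod (g x))\<^sup>2)"
      using L2D(2)[OF f] L2D(2)[OF g] by simp
    show "AE x in half_line. norm ((cmod (f x + g x))\<^sup>2) \<le> norm ((1 + 1) * (cmod (f x))\<^sup>2 + (1 + 1 / 1) * (cmod (g x))\<^sup>2)"
      using norm_add_sq_le[of 1] by (intro AE_I2) simp
  qed measurable
  then show ?thesis by (simp add: L2_def)
qed

lemma L2_diff: "f \<in> L2 \<Longrightarrow> g \<in> L2 \<Longrightarrow> (\<lambda>x. f x - g x) \<in> L2"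
  using L2_add[of f "\<lambda>x. (-1) * g x"] L2_scale[of g "-1"] by simp

lemma L2_divide: "f \<in> L2 \<Longrightarrow> (\<lambda>x. f x / c) \<in> L2"
  using L2_scale[of f "1/c"] by simp

lemma L2_sum: "finite I \<Longrightarrow> (\<And>i. i \<in> I \<Longrightarrow> f i \<in> L2) \<Longrightarrow> (\<lambda>x. \<Sum>i\<in>I. f i x) \<in> L2"
proof (induction I rule: finite_induct)
  case empty
  then show ?case by (simp add: L2_def)
next
  case (insert i I)
  then show ?case by (simp add: L2_add)
qed

lemma L2norm_nonneg: "0 \<le> L2norm f"
  by (simp add: L2norm_def)

lemma L2norm_sq: "(L2norm f)\<^sup>2 = (\<integral>x. (cmod (f x))\<^sup>2 \<partial>half_line)"
  by (simp add: L2norm_def)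

lemma L2norm_scale: "L2norm (\<lambda>x. c * f x) = cmod c * L2norm f"
  by (simp add: L2norm_def norm_mult power_mult_distrib real_sqrt_mult)

lemma L2norm_cong:
  assumes "f \<in> L2" "g \<in> L2" "ae_eq f g"
  shows "L2norm f = L2norm g"
proof -
  note [measurable] = L2D(1)[OF assms(1)] L2D(1)[OF assms(2)]
  have "(\<integral>x. (cmod (f x))\<^sup>2 \<partial>half_line) = (\<integral>x. (cmod (g x))\<^sup>2 \<partial>half_line)"
    using assms(3) unfolding ae_eq_def by (intro integral_cong_AE) auto
  then show ?thesis by (simp add: L2norm_def)
qed

lemma L2norm_add_le:
  assumes f: "f \<in> L2" and g: "g \<in> L2"
  shows "L2norm (\<lambda>x. f x + g x) \<le> L2norm f + L2norm g"
proof (rule field_le_epsilon)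
  fix e :: real assume "e > 0"
  \<comment> \<open>The extra \<open>e / 2\<close> keeps the ratio \<open>s = B / A\<close> positive
    when a norm vanishes; with this \<open>s\<close> the right-hand side is exactly (A +
    B)^2.\<close>
  define A B where "A = L2norm f + e / 2" and "B = L2norm g + e / 2"
  have AB: "A > 0" "B > 0" "L2norm f \<le> A" "L2norm g \<le> B"
    using \<open>e > 0\<close> L2norm_nonneg[of f] L2norm_nonneg[of g] by (auto simp: A_def B_def)
  define s where "s = B / A"
  have s: "s > 0" using AB by (simp add: s_def)
  have "(L2norm (\<lambda>x. f x + g x))\<^sup>2 \<le> (\<integral>x. (1 + s) * (cmod (f x))\<^sup>2 + (1 + 1 / s) * (cmod (g x))\<^sup>2 \<partial>half_line)"
    unfolding L2norm_sq using L2D(2)[OF f] L2D(2)[OF g] L2D(2)[OF L2_add[OF f g]] norm_add_sq_le[OF s]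
    by (intro integral_mono) auto
  also have "\<dots> = (1 + s) * (L2norm f)\<^sup>2 + (1 + 1 / s) * (L2norm g)\<^sup>2"
    unfolding L2norm_sq using L2D(2)[OF f] L2D(2)[OF g] by simp
  also have "\<dots> \<le> (1 + s) * A\<^sup>2 + (1 + 1 / s) * B\<^sup>2"
    using s AB L2norm_nonneg by (intro add_mono mult_left_mono power_mono) auto
  also have "\<dots> = (A + B)\<^sup>2"
  proof -
    have "(1 + s) * A\<^sup>2 = (A + B) * A" "(1 + 1 / s) * B\<^sup>2 = (A + B) * B"
      using AB(1,2) by (simp_all add: s_def power2_eq_square distrib_right)
    then show ?thesis by (simp add: power2_eq_square algebra_simps)
  qed
  finally have "(L2norm (\<lambda>x. f x + g x))\<^sup>2 \<le> (A + B)\<^sup>2" .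
  moreover have "0 \<le> A + B" using AB(1,2) by linarith
  ultimately have "L2norm (\<lambda>x. f x + g x) \<le> A + B"
    by (rule power2_le_imp_le)
  then show "L2norm (\<lambda>x. f x + g x) \<le> L2norm f + L2norm g + e"
    by (simp add: A_def B_def)
qed

lemma L2norm_diff_le:
  assumes f: "f \<in> L2" and g: "g \<in> L2"
  shows "L2norm (\<lambda>x. f x - g x) \<le> L2norm f + L2norm g"
  using L2norm_add_le[OF f L2_scale[OF g, of "-1"]] L2norm_scale[of "-1" g] by simp

lemma L2norm_diff_triangle:
  assumes "f \<in> L2" "g \<in> L2" "h \<in> L2"
  shows "\<bar>L2norm (\<lambda>x. f x - h x) - L2norm (\<lambda>x. g x - h x)\<bar> \<le> L2norm (\<lambda>x. f x - g x)"
proof -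
  have 1: "L2norm (\<lambda>x. f x - h x) \<le> L2norm (\<lambda>x. f x - g x) + L2norm (\<lambda>x. g x - h x)"
    using L2norm_add_le[OF L2_diff[OF assms(1,2)] L2_diff[OF assms(2,3)]] by simp
  have 2: "L2norm (\<lambda>x. g x - h x) \<le> L2norm (\<lambda>x. f x - g x) + L2norm (\<lambda>x. f x - h x)"
    using L2norm_diff_le[OF L2_diff[OF assms(1,3)] L2_diff[OF assms(1,2)]] by simp
  show ?thesis using 1 2 by linarith
qed

lemma L2norm_eq_0:
  assumes "f \<in> L2" "L2norm f = 0"
  shows "AE x in half_line. f x = 0"
proof -
  have "(\<integral>x. (cmod (f x))\<^sup>2 \<partial>half_line) = 0"
    using L2norm_sq[of f] assms(2) by simp
  then have "AE x in half_line. (cmod (f x))\<^sup>2 = 0"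
    using integral_nonneg_eq_0_iff_AE[OF L2D(2)[OF assms(1)]] by simp
  then show ?thesis by simp
qed

section \<open>One-parameter unitary groups and uniqueness of orbits\<close>

lemma unitary_groupD:
  assumes "unitary_group U"
  shows "f \<in> L2 \<Longrightarrow> U t f \<in> L2"
    and "f \<in> L2 \<Longrightarrow> g \<in> L2 \<Longrightarrow> ae_eq f g \<Longrightarrow> ae_eq (U t f) (U t g)"
    and "f \<in> L2 \<Longrightarrow> g \<in> L2 \<Longrightarrow> ae_eq (U t (\<lambda>x. a * f x + b * g x)) (\<lambda>x. a * U t f x + b * U t g x)"
    and "f \<in> L2 \<Longrightarrow> L2norm (U t f) = L2norm f"
    and "f \<in> L2 \<Longrightarrow> ae_eq (U 0 f) f"
    and "f \<in> L2 \<Longrightarrow> ae_eq (U (s + t) f) (U s (U t f))"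
  using assms by (auto simp: unitary_group_def)

lemma unitary_group_diff:
  assumes "unitary_group U" "f \<in> L2" "g \<in> L2"
  shows "ae_eq (U t (\<lambda>x. f x - g x)) (\<lambda>x. U t f x - U t g x)"
  using unitary_groupD(3)[OF assms, of t 1 "-1"] by simp

lemma unitary_group_zero:
  assumes "unitary_group U"
  shows "ae_eq (U t (\<lambda>x. 0)) (\<lambda>x. 0)"
proof -
  have "(\<lambda>x. 0) \<in> L2" by (simp add: L2_def)
  from unitary_groupD(3)[OF assms this this, of t 0 0] show ?thesis by simp
qed

lemma unitary_group_sum:
  assumes U: "unitary_group U" and "finite I" and "\<And>i. i \<in> I \<Longrightarrow> f i \<in> L2"
  shows "ae_eq (U t (\<lambda>x. \<Sum>i\<in>I. c i * f i x)) (\<lambda>x. \<Sum>i\<in>I. c i * U t (f i) x)"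
  using assms(2,3)
proof (induction I rule: finite_induct)
  case empty
  then show ?case using unitary_group_zero[OF U] by simp
next
  case (insert i I)
  have "ae_eq (U t (\<lambda>x. c i * f i x + 1 * (\<Sum>i\<in>I. c i * f i x)))
    (\<lambda>x. c i * U t (f i) x + 1 * U t (\<lambda>x. \<Sum>i\<in>I. c i * f i x) x)"
    using insert by (intro unitary_groupD(3)[OF U] L2_sum L2_scale) auto
  moreover have "ae_eq (U t (\<lambda>x. \<Sum>i\<in>I. c i * f i x)) (\<lambda>x. \<Sum>i\<in>I. c i * U t (f i) x)"
    using insert by simp
  ultimately show ?case
    unfolding ae_eq_def sum.insert[OF insert(1,2)] by eventually_elim simp
qed

text \<open>The distance \<open>n s\<close> of \<open>u s\<close> to \<open>U s (u 0)\<close> has derivative \<open>0\<close>, because \<open>U h\<close> is isometric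
  and both \<open>u (s + h)\<close> and \<open>U h (u s)\<close> agree with \<open>u s - \<i> h g s\<close> up to \<open>o(h)\<close>.\<close>

lemma exp_group_unique_solution:
  assumes AU: "is_exp_group A U"
    and u: "\<And>s. u s \<in> L2" and g: "\<And>s. g s \<in> L2" and A: "\<And>s. (u s, g s) \<in> A"
    and lim: "\<And>s. ((\<lambda>h. L2norm (\<lambda>x. (u (s + h) x - u s x) / complex_of_real h - (- \<i> * g s x))) \<longlongrightarrow> 0) (at 0)"
  shows "ae_eq (U t (u 0)) (u t)"
proof -
  have U: "unitary_group U" using AU by (simp add: is_exp_group_def)
  note UL = unitary_groupD(1)[OF U]
  define n where "n s = L2norm (\<lambda>x. u s x - U s (u 0) x)" for s
  have deriv: "(n has_field_derivative 0) (at s)" for s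
  proof -
    define r1 where "r1 h = L2norm (\<lambda>x. (u (s + h) x - u s x) / complex_of_real h - (- \<i> * g s x))" for h
    define r2 where "r2 h = L2norm (\<lambda>x. (U h (u s) x - u s x) / complex_of_real h - (- \<i> * g s x))" for h
    have r1: "(r1 \<longlongrightarrow> 0) (at 0)" unfolding r1_def by (rule lim)
    have r2: "(r2 \<longlongrightarrow> 0) (at 0)"
      using AU A[of s] u[of s] g[of s] unfolding is_exp_group_def r2_def by blast
    have est: "\<bar>n (s + h) - n s\<bar> \<le> \<bar>h\<bar> * (r1 h + r2 h)" if "h \<noteq> 0" for h
    proof -
      have "n s = L2norm (U h (\<lambda>x. u s x - U s (u 0) x))"
        unfolding n_def using unitary_groupD(4)[OF U L2_diff[OF u UL[OF u]]] by simp
      also have "\<dots> = L2norm (\<lambda>x. U h (u s) x - U h (U s (u 0)) x)"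
        by (intro L2norm_cong unitary_group_diff[OF U] UL L2_diff u)
      also have "\<dots> = L2norm (\<lambda>x. U h (u s) x - U (s + h) (u 0) x)"
        using unitary_groupD(6)[OF U u, of h s 0] unfolding ae_eq_def
        by (intro L2norm_cong UL L2_diff u) (auto simp: ae_eq_def add.commute)
      finally have ns: "n s = L2norm (\<lambda>x. U h (u s) x - U (s + h) (u 0) x)" .
      have "\<bar>n (s + h) - n s\<bar> \<le> L2norm (\<lambda>x. u (s + h) x - U h (u s) x)"
        unfolding ns unfolding n_def by (intro L2norm_diff_triangle UL u)
      also have "(\<lambda>x. u (s + h) x - U h (u s) x) = (\<lambda>x. complex_of_real h *
          (((u (s + h) x - u s x) / complex_of_real h - (- \<i> * g s x)) -
           ((U h (u s) x - u s x) / complex_of_real h - (- \<i> * g s x))))"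
        using that by (simp add: right_diff_distrib diff_divide_distrib)
      also have "L2norm \<dots> \<le> \<bar>h\<bar> * (r1 h + r2 h)"
        unfolding L2norm_scale r1_def r2_def norm_of_real
        by (intro mult_left_mono L2norm_diff_le L2_diff L2_divide L2_scale UL u g) auto
      finally show ?thesis .
    qed
    have "((\<lambda>h. (n (s + h) - n s) / h) \<longlongrightarrow> 0) (at 0)"
    proof (rule Lim_null_comparison)
      show "((\<lambda>h. r1 h + r2 h) \<longlongrightarrow> 0) (at 0)"
        using tendsto_add[OF r1 r2] by simp
      show "\<forall>\<^sub>F h in at 0. norm ((n (s + h) - n s) / h) \<le> r1 h + r2 h"
        unfolding eventually_at_filter
        using est by (intro always_eventually) (simp add: field_simps abs_mult)
    qed
    then show ?thesis by (simp add: DERIV_def)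
  qed
  have n0: "n 0 = 0"
  proof -
    have "n 0 = L2norm (\<lambda>x. 0)" unfolding n_def
      using unitary_groupD(5)[OF U u, of 0]
      by (intro L2norm_cong L2_diff UL u) (auto simp: L2_def ae_eq_def)
    then show ?thesis by (simp add: L2norm_def)
  qed
  have "n t = n 0" using deriv by (intro DERIV_isconst_all) auto
  then have "AE x in half_line. u t x - U t (u 0) x = 0"
    using n0 unfolding n_def by (intro L2norm_eq_0 L2_diff UL u) auto
  then show ?thesis unfolding ae_eq_def by eventually_elim simp
qed

section \<open>Gaussian moments and absolute continuity\<close>

lemma L2_dominated:
  assumes f: "f \<in> borel_measurable half_line" and g: "g \<in> L2"
    and le: "\<And>x. x > 0 \<Longrightarrow> cmod (f x) \<le> cmod (g x)"
  shows "f \<in> L2" "L2norm f \<le> L2norm g"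
proof -
  note [measurable] = f
  have int: "integrable half_line (\<lambda>x. (cmod (f x))\<^sup>2)"
    using le by (intro Bochner_Integration.integrable_bound[OF L2D(2)[OF g]] AE_half_lineI)
      (auto intro: power_mono)
  then show "f \<in> L2" using f by (simp add: L2_def)
  show "L2norm f \<le> L2norm g"
    unfolding L2norm_def using le
    by (intro real_sqrt_le_mono integral_mono int L2D(2)[OF g] power_mono) auto
qed

lemma integrable_half_line_iff:
  fixes f :: "real \<Rightarrow> 'a::{banach, second_countable_topology}"
  shows "integrable half_line f \<longleftrightarrow> set_integrable lborel {0<..} f"
  unfolding half_line_def set_integrable_def by (subst integrable_restrict_space) auto

lemma integral_half_line_eq:
  fixes f :: "real \<Rightarrow> 'a::{banach, second_countable_topology}"
  shows "integral\<^sup>L half_line f = (LINT x:{0<..}|lborel. f x)"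
  unfolding half_line_def set_lebesgue_integral_def by (subst integral_restrict_space) auto

text \<open>Euler's integral for Gamma under t = b y^2. The exponent is parametrized as
  \<open>2 * s - 1\<close> so that, at s = k + 1/2 - l, the value carries precisely the Gamma factor
  in the denominator of the k-th Bessel coefficient.\<close>

lemma has_integral_gaussian_moment:
  assumes s: "s > (0::real)" and b: "b > 0"
  shows "has_bochner_integral half_line (\<lambda>y. y powr (2 * s - 1) * exp (- b * y\<^sup>2)) (Gamma s / (2 * b powr s))"
proof -
  define f where "f t = t powr (s - 1) / exp t" for t :: real
  define g where "g y = b * y\<^sup>2" for y :: real
  have img: "g ` {0<..} = {0<..}"
  proof (intro equalityI subsetI)
    fix t :: real assume "t \<in> {0<..}"
    then have "t = g (sqrt (t / b))" "sqrt (t / b) \<in> {0<..}"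
      using b by (auto simp: g_def)
    then show "t \<in> g ` {0<..}" by blast
  qed (use b in \<open>auto simp: g_def\<close>)
  have inj: "inj_on g {0<..}" using b by (auto simp: g_def inj_on_def)
  have "(f has_integral Gamma s) {0..}" unfolding f_def by (rule Gamma_integral_real[OF s])
  then have "((\<lambda>t. if t \<in> {0<..} then f t else 0) has_integral Gamma s) {0..}"
    by (rule has_integral_spike [of "{0}", rotated 2]) auto
  then have f: "(f has_integral Gamma s) {0<..}"
    by (subst (asm) has_integral_restrict) auto
  then have fabs: "f absolutely_integrable_on {0<..}"
    by (intro nonnegative_absolutely_integrable_1) (auto simp: f_def integrable_on_def)
  define h where "h y = 2 * b powr s * (y powr (2 * s - 1) * exp (- b * y\<^sup>2))" for y :: real
  have "(g has_field_derivative 2 * b * y) (at y within {0<..})" for y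
    unfolding g_def by (auto intro!: derivative_eq_intros)
  then have integrable_f: "(\<lambda>y. \<bar>2 * b * y\<bar> * f (g y)) absolutely_integrable_on {0<..} \<and>
        integral {0<..} (\<lambda>y. \<bar>2 * b * y\<bar> * f (g y)) = Gamma s"
    using integral_unique[OF f] fabs img
    by (subst has_absolute_integral_change_of_variables_1'[OF _ _ inj]) auto
  have eq: "\<bar>2 * b * y\<bar> * f (g y) = h y" if "y \<in> {0<..}" for y
  proof -
    have "f (g y) = b powr (s - 1) * y powr (2 * (s - 1)) * exp (- b * y\<^sup>2)"
    proof -
      have "y\<^sup>2 powr (s - 1) = y powr (2 * (s - 1))"
        using that powr_powr[of y 2 "s - 1"] by simp
      then show ?thesis using that b by (simp add: f_def g_def powr_mult exp_minus divide_inverse)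
    qed
    moreover have "2 * b * (b powr (s - 1) * y powr (2 * (s - 1))) * y = 2 * b powr s * y powr (2 * s - 1)"
    proof -
      have "b powr s = b powr (1 + (s - 1))" "y powr (2 * s - 1) = y powr (1 + 2 * (s - 1))"
        by (simp_all add: algebra_simps)
      then show ?thesis using that b unfolding powr_add by simp
    qed
    ultimately show ?thesis using that b unfolding h_def by (simp add: abs_mult algebra_simps)
  qed
  have integrable: "(\<lambda>y. \<bar>2 * b * y\<bar> * f (g y)) absolutely_integrable_on {0<..} \<longleftrightarrow> h absolutely_integrable_on {0<..}"
    by (intro set_integrable_cong refl eq)
  have integral: "integral {0<..} h = integral {0<..} (\<lambda>y. \<bar>2 * b * y\<bar> * f (g y))"
    by (intro integral_cong eq[symmetric])
  have h: "h absolutely_integrable_on {0<..}" "integral {0<..} h = Gamma s"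
    using integrable integrable_f by (simp_all add: integral)
  \<comment> \<open>The change of variables lives on the completed measure; Borel measurability of
    \<open>h\<close> allows the return to \<open>lborel\<close>.\<close>
  have "set_integrable lborel {0<..} h"
    using h(1) unfolding set_integrable_def
    by (subst (asm) integrable_completion) (auto simp: h_def)
  then have "has_bochner_integral half_line h (Gamma s)"
    using h(2) by (simp add: has_bochner_integral_iff integrable_half_line_iff integral_half_line_eq
        set_borel_integral_eq_integral(2))
  then have "has_bochner_integral half_line (\<lambda>y. h y * (1 / (2 * b powr s))) (Gamma s * (1 / (2 * b powr s)))"
    by (rule has_bochner_integral_mult_left[rotated]) 
  then show ?thesis using b by (simp add: h_def)
qed

lemma gaussian_moment_integrable:
  assumes "c > (-1::real)" "b > 0"
  shows "integrable half_line (\<lambda>y. y powr c * exp (- b * y\<^sup>2))"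
proof -
  have "2 * ((c + 1) / 2) - 1 = c" by (simp add: field_simps)
  from has_integral_gaussian_moment[of "(c + 1) / 2" b, unfolded this] assms show ?thesis
    by (simp add: has_bochner_integral_iff)
qed

text \<open>For c = -l the hypothesis on \<open>c\<close> reads l < 1/2, the condition for x^(-l) to
  be square integrable at 0.\<close>

lemma gaussian_moment_L2:
  assumes "c > (-1/2::real)" "b > 0"
  shows "(\<lambda>y. complex_of_real (y powr c * exp (- b * y\<^sup>2))) \<in> L2"
proof -
  have "integrable half_line (\<lambda>y. y powr (2 * c) * exp (- (2 * b) * y\<^sup>2))"
    using assms by (intro gaussian_moment_integrable) auto
  also have "(\<lambda>y. y powr (2 * c) * exp (- (2 * b) * y\<^sup>2)) =
      (\<lambda>y. (cmod (complex_of_real (y powr c * exp (- b * y\<^sup>2))))\<^sup>2)"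
    unfolding norm_of_real power2_abs power_mult_distrib
    by (simp add: power2_eq_square powr_add[symmetric] exp_add[symmetric] algebra_simps)
  finally show ?thesis by (simp add: L2_def)
qed

section \<open>Local absolute continuity of continuously differentiable functions\<close>

lemma lipschitz_imp_abs_continuous_on_interval:
  assumes B: "\<And>x y. x \<in> {a..b} \<Longrightarrow> y \<in> {a..b} \<Longrightarrow> cmod (f y - f x) \<le> B * \<bar>y - x\<bar>"
  shows "abs_continuous_on_interval a b f"
  unfolding abs_continuous_on_interval_def
proof (intro allI impI)
  fix e :: real assume e: "e > 0"
  define d where "d = e / (\<bar>B\<bar> + 1)"
  have "(\<Sum>K\<in>\<D>. cmod (f (Sup K) - f (Inf K))) < e"
    if \<D>: "\<D> division_of S" "S \<subseteq> {a..b}" "(\<Sum>K\<in>\<D>. Sup K - Inf K) < d" for \<D> S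
  proof -
    have "cmod (f (Sup K) - f (Inf K)) \<le> (\<bar>B\<bar> + 1) * (Sup K - Inf K)" if K: "K \<in> \<D>" for K
    proof -
      obtain c c' where c: "K = cbox c c'" using division_ofD(4)[OF \<D>(1) K] by blast
      have "K \<noteq> {}" "K \<subseteq> {a..b}" using division_ofD(2,3)[OF \<D>(1) K] \<D>(2) by auto
      then have "c \<le> c'" "c \<in> {a..b}" "c' \<in> {a..b}" using c by auto
      then have "cmod (f c' - f c) \<le> B * \<bar>c' - c\<bar>" by (intro B)
      also have "\<dots> \<le> (\<bar>B\<bar> + 1) * \<bar>c' - c\<bar>" by (intro mult_right_mono) auto
      finally show ?thesis using \<open>c \<le> c'\<close> by (simp add: c)
    qed
    then have "(\<Sum>K\<in>\<D>. cmod (f (Sup K) - f (Inf K))) \<le> (\<bar>B\<bar> + 1) * (\<Sum>K\<in>\<D>. Sup K - Inf K)"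
      unfolding sum_distrib_left by (rule sum_mono)
    also have "\<dots> < (\<bar>B\<bar> + 1) * d" using \<D>(3) by (intro mult_strict_left_mono) auto
    also have "\<dots> = e" by (simp add: d_def)
    finally show ?thesis .
  qed
  moreover have "d > 0" using e by (simp add: d_def)
  ultimately show "\<exists>\<delta>>0. \<forall>\<D> S. \<D> division_of S \<longrightarrow> S \<subseteq> {a..b} \<longrightarrow>
        (\<Sum>K\<in>\<D>. Sup K - Inf K) < \<delta> \<longrightarrow> (\<Sum>K\<in>\<D>. cmod (f (Sup K) - f (Inf K))) < e"
    by blast
qed

lemma C1_imp_locally_abs_continuous:
  assumes f': "\<And>x. x > 0 \<Longrightarrow> (f has_vector_derivative f' x) (at x)"
    and cont: "continuous_on {0<..} f'"
  shows "locally_abs_continuous f"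
  unfolding locally_abs_continuous_def
proof (intro allI impI)
  fix a b :: real assume ab: "0 < a" "a < b"
  have "compact (f' ` {a..b})"
    using ab by (intro compact_continuous_image continuous_on_subset[OF cont]) auto
  then obtain B where B: "\<And>x. x \<in> {a..b} \<Longrightarrow> cmod (f' x) \<le> B"
    using compact_imp_bounded bounded_iff by (metis imageI)
  show "abs_continuous_on_interval a b f"
  proof (rule lipschitz_imp_abs_continuous_on_interval)
    fix x y assume xy: "x \<in> {a..b}" "y \<in> {a..b}"
    have "norm (f y - f x) \<le> B * norm (y - x)"
    proof (rule differentiable_bound[of "{a..b}" f "\<lambda>x h. h *\<^sub>R f' x"])
      fix z assume z: "z \<in> {a..b}"
      then show "(f has_derivative (\<lambda>h. h *\<^sub>R f' z)) (at z within {a..b})"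
        using f'[of z] ab unfolding has_vector_derivative_def
        by (auto intro: has_derivative_at_withinI)
      show "onorm (\<lambda>h. h *\<^sub>R f' z) \<le> B"
        using B[OF z] by (intro onorm_le) (auto simp: mult.commute[of B] intro!: mult_left_mono)
    qed (use xy in auto)
    then show "cmod (f y - f x) \<le> B * \<bar>y - x\<bar>" by simp
  qed
qed

section \<open>Gaussians at complex time\<close>

text \<open>The product of \<open>x\<^sup>-\<^sup>l\<close> and the heat kernel of the radial Laplacian in \<open>1 - 2 l\<close> dimensions
  at complex time \<open>z\<close>.\<close>

definition gauss :: "real \<Rightarrow> complex \<Rightarrow> real \<Rightarrow> complex" where
  "gauss l z x = complex_of_real (x powr (-l)) * z powr (- complex_of_real (1/2 - l)) *
     exp (- (complex_of_real (x\<^sup>2 / 4) / z))"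

text \<open>The derivative is taken in the complex time \<open>z\<close>; derivatives in
  \<open>x\<close> are expressed by \<open>gauss_logderiv\<close> and
  \<open>gauss_dxx\<close>.\<close>

definition gauss_deriv :: "real \<Rightarrow> complex \<Rightarrow> real \<Rightarrow> complex" where
  "gauss_deriv l z x = gauss l z x * (complex_of_real (x\<^sup>2 / 4) / z\<^sup>2 - complex_of_real (1/2 - l) / z)"

definition gauss_deriv2 :: "real \<Rightarrow> complex \<Rightarrow> real \<Rightarrow> complex" where
  "gauss_deriv2 l z x = gauss l z x *
     ((complex_of_real (x\<^sup>2 / 4) / z\<^sup>2 - complex_of_real (1/2 - l) / z)\<^sup>2 +
      (complex_of_real (1/2 - l) / z\<^sup>2 - 2 * complex_of_real (x\<^sup>2 / 4) / z ^ 3))"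

lemma gauss_measurable [measurable]: "gauss l z \<in> borel_measurable half_line"
  unfolding gauss_def by measurable

lemma gauss_deriv_measurable [measurable]: "gauss_deriv l z \<in> borel_measurable half_line"
  unfolding gauss_deriv_def by measurable

lemma gauss_has_deriv:
  assumes "Re z > 0"
  shows "((\<lambda>z. gauss l z x) has_field_derivative gauss_deriv l z x) (at z)"
proof -
  have z: "z \<noteq> 0" "z \<notin> \<real>\<^sub>\<le>\<^sub>0" using assms by (auto simp: complex_nonpos_Reals_iff)
  define p q where "p = complex_of_real (1/2 - l)" and "q = complex_of_real (x\<^sup>2 / 4)"
  have 1: "((\<lambda>z. z powr (- p)) has_field_derivative - p * (z powr (- p) / z)) (at z)"
    using has_field_derivative_powr[OF z(2), of "- p"] z by (simp add: powr_diff)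
  have 2: "((\<lambda>z. exp (- (q / z))) has_field_derivative exp (- (q / z)) * (q / z\<^sup>2)) (at z)"
    using z by (auto intro!: derivative_eq_intros simp: power2_eq_square)
  from DERIV_cmult[OF DERIV_mult[OF 1 2], of "complex_of_real (x powr (- l))"] show ?thesis
    unfolding gauss_def gauss_deriv_def p_def[symmetric] q_def[symmetric]
    by (simp add: algebra_simps)
qed

lemma gauss_deriv_has_deriv:
  assumes "Re z > 0"
  shows "((\<lambda>z. gauss_deriv l z x) has_field_derivative gauss_deriv2 l z x) (at z)"
proof -
  have z: "z \<noteq> 0" using assms by auto
  define p q where "p = complex_of_real (1/2 - l)" and "q = complex_of_real (x\<^sup>2 / 4)"
  have 1: "((\<lambda>z. q / z\<^sup>2) has_field_derivative - (2 * q / z ^ 3)) (at z)"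
    using z by (auto intro!: derivative_eq_intros simp: eval_nat_numeral)
  have 2: "((\<lambda>z. p / z) has_field_derivative - (p / z\<^sup>2)) (at z)"
    using z by (auto intro!: derivative_eq_intros simp: power2_eq_square)
  have "((\<lambda>z. q / z\<^sup>2 - p / z) has_field_derivative (p / z\<^sup>2 - 2 * q / z ^ 3)) (at z)"
    using DERIV_diff[OF 1 2] by simp
  note d = DERIV_mult[OF gauss_has_deriv[OF assms, of l x] this]
  have g: "gauss_deriv l z x = gauss l z x * (q / z\<^sup>2 - p / z)" for z
    by (simp only: gauss_deriv_def p_def q_def)
  have g2: "gauss_deriv2 l z x = gauss l z x * ((q / z\<^sup>2 - p / z)\<^sup>2 + (p / z\<^sup>2 - 2 * q / z ^ 3))"
    by (simp only: gauss_deriv2_def p_def q_def)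
  have "gauss_deriv2 l z x = gauss_deriv l z x * (q / z\<^sup>2 - p / z) + (p / z\<^sup>2 - 2 * q / z ^ 3) * gauss l z x"
    unfolding g g2 power2_eq_square[of "q / z\<^sup>2 - p / z"] by (simp only: distrib_left mult_ac)
  with d show ?thesis unfolding g[symmetric] by simp
qed

section \<open>Bounds uniform over a bounded set of complex times\<close>

context
  fixes l r R :: real
  assumes l: "l \<in> {-1/2<..<1/2}" and r: "r > 0" and R: "R > 0"
begin

definition gauss_bound :: "real \<Rightarrow> real" where
  "gauss_bound x = x powr (-l) * r powr (- (1/2 - l)) * exp (- (r / (4 * R\<^sup>2)) * x\<^sup>2)"

lemma gauss_bound_nonneg: "0 \<le> gauss_bound x"
  by (simp add: gauss_bound_def)

text \<open>The power has a real negative exponent, so its norm depends only on |z| \<ge> Re z \<ge>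
  r. The exponential decays at rate Re (1/z) / 4, and Re (1/z) = Re z / |z|^2 \<ge> r / R^2.\<close>

lemma norm_gauss_le:
  assumes z: "Re z \<ge> r" "cmod z \<le> R"
  shows "cmod (gauss l z x) \<le> gauss_bound x"
proof -
  have zr: "cmod z \<ge> r" using z(1) complex_Re_le_cmod[of z] by linarith
  have "cmod (z powr (- complex_of_real (1/2 - l))) = cmod z powr (- (1/2 - l))"
    by (subst norm_powr_real_powr') auto
  also have "\<dots> \<le> r powr (- (1/2 - l))" using zr r l by (intro powr_mono2') auto
  finally have 1: "cmod (z powr (- complex_of_real (1/2 - l))) \<le> r powr (- (1/2 - l))" .
  have "r / R\<^sup>2 \<le> Re z / (cmod z)\<^sup>2"
    using z zr r R by (intro frac_le power_mono) auto
  also have "\<dots> = Re (1 / z)" by (simp add: Re_divide cmod_power2)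
  finally have "x\<^sup>2 / 4 * (r / R\<^sup>2) \<le> x\<^sup>2 / 4 * Re (1 / z)" by (intro mult_left_mono) auto
  also have "a * Re (1 / z) = Re (complex_of_real a / z)" for a
    by (simp add: Re_divide)
  finally have "x\<^sup>2 / 4 * (r / R\<^sup>2) \<le> Re (complex_of_real (x\<^sup>2 / 4) / z)" .
  then have 2: "cmod (exp (- (complex_of_real (x\<^sup>2 / 4) / z))) \<le> exp (- (r / (4 * R\<^sup>2)) * x\<^sup>2)"
    by (simp add: mult.commute)
  show ?thesis
    unfolding gauss_def gauss_bound_def norm_mult
    by (intro mult_mono 1 2) auto
qed

lemma norm_gauss_deriv_aux:
  assumes z: "Re z \<ge> r" "cmod z \<le> R"
  shows "cmod (complex_of_real (x\<^sup>2 / 4) / z\<^sup>2 - complex_of_real (1/2 - l) / z) \<le> x\<^sup>2 / 4 / r\<^sup>2 + (1/2 - l) / r"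
    and "cmod (complex_of_real (1/2 - l) / z\<^sup>2 - 2 * complex_of_real (x\<^sup>2 / 4) / z ^ 3) \<le>
      (1/2 - l) / r\<^sup>2 + 2 * (x\<^sup>2 / 4) / r ^ 3"
proof -
  have zr: "cmod z \<ge> r" using z(1) complex_Re_le_cmod[of z] by linarith
  have l': "1/2 - l \<ge> 0" using l by simp
  have "cmod z > 0" using zr r by linarith
  then have p: "cmod (complex_of_real c / z ^ n) \<le> c / r ^ n" if "c \<ge> 0" for c n
  proof -
    have "c / cmod z ^ n \<le> c / r ^ n"
      using zr r that \<open>cmod z > 0\<close> by (intro divide_left_mono power_mono mult_pos_pos zero_less_power) auto
    then show ?thesis using that by (simp add: norm_divide norm_power)
  qed
  have q: "0 \<le> x\<^sup>2 / 4" "0 \<le> 2 * (x\<^sup>2 / 4)" by simp_all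
  show "cmod (complex_of_real (x\<^sup>2 / 4) / z\<^sup>2 - complex_of_real (1/2 - l) / z) \<le> x\<^sup>2 / 4 / r\<^sup>2 + (1/2 - l) / r"
    by (rule order_trans[OF norm_triangle_ineq4 add_mono[OF p[OF q(1)] p[OF l', of 1, unfolded power_one_right]]])
  show "cmod (complex_of_real (1/2 - l) / z\<^sup>2 - 2 * complex_of_real (x\<^sup>2 / 4) / z ^ 3) \<le>
      (1/2 - l) / r\<^sup>2 + 2 * (x\<^sup>2 / 4) / r ^ 3"
    by (rule order_trans[OF norm_triangle_ineq4 add_mono[OF p[OF l'] p[OF q(2), of 3, unfolded of_real_mult of_real_numeral]]])
qed

definition gauss_deriv2_bound :: "real \<Rightarrow> real" where
  "gauss_deriv2_bound x = gauss_bound x * ((x\<^sup>2 / 4 / r\<^sup>2 + (1/2 - l) / r)\<^sup>2 +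
      ((1/2 - l) / r\<^sup>2 + 2 * (x\<^sup>2 / 4) / r ^ 3))"

lemma norm_gauss_deriv2_le:
  assumes z: "Re z \<ge> r" "cmod z \<le> R"
  shows "cmod (gauss_deriv2 l z x) \<le> gauss_deriv2_bound x"
  unfolding gauss_deriv2_def gauss_deriv2_bound_def norm_mult
  by (rule mult_mono[OF norm_gauss_le[OF z] norm_triangle_mono gauss_bound_nonneg norm_ge_zero],
      subst norm_power, intro power_mono norm_gauss_deriv_aux[OF z] norm_ge_zero, rule norm_gauss_deriv_aux[OF z])

text \<open>Each derivative in \<open>z\<close> raises the degree of the polynomial factor in x^2 by
  one, so j = 0, 1, 2 cover the Gaussian and its first two derivatives.\<close>

lemma gauss_bound_powers_L2: "(\<lambda>x. complex_of_real (gauss_bound x * (x\<^sup>2) ^ j)) \<in> L2"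
proof -
  have m: "(\<lambda>x. complex_of_real (gauss_bound x * (x\<^sup>2) ^ j)) \<in> borel_measurable half_line"
    unfolding gauss_bound_def by measurable
  have "(\<lambda>x. complex_of_real (r powr (- (1/2 - l))) *
      complex_of_real (x powr (- l + 2 * real j) * exp (- (r / (4 * R\<^sup>2)) * x\<^sup>2))) \<in> L2"
    using l r R by (intro L2_scale gaussian_moment_L2) auto
  then show ?thesis
  proof (rule L2_dominated(1)[OF m])
    fix x :: real assume x: "x > 0"
    have "x powr (2 * real j) = (x\<^sup>2) ^ j"
      using powr_realpow[OF x, of "2 * j"] by (simp add: power_mult)
    then have "gauss_bound x * (x\<^sup>2) ^ j = r powr (- (1/2 - l)) *
        (x powr (- l + 2 * real j) * exp (- (r / (4 * R\<^sup>2)) * x\<^sup>2))"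
      unfolding gauss_bound_def powr_add by (simp only: mult_ac)
    then show "cmod (complex_of_real (gauss_bound x * (x\<^sup>2) ^ j)) \<le>
      cmod (complex_of_real (r powr (- (1/2 - l))) *
      complex_of_real (x powr (- l + 2 * real j) * exp (- (r / (4 * R\<^sup>2)) * x\<^sup>2)))"
      by (simp only: of_real_mult order_refl)
  qed
qed

lemma gauss_deriv2_bound_L2: "(\<lambda>x. complex_of_real (gauss_deriv2_bound x)) \<in> L2"
proof -
  \<comment> \<open>The coefficients of 1, x^2 and x^4 in the expanded polynomial factor.\<close>
  define A B C where "A = (1/2 - l)\<^sup>2 / r\<^sup>2 + (1/2 - l) / r\<^sup>2"
    and "B = (1/2 - l) / r ^ 3 / 2 + 1 / r ^ 3 / 2" and "C = 1 / r ^ 4 / 16"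
  have eq: "gauss_deriv2_bound x = A * (gauss_bound x * (x\<^sup>2) ^ 0) + B * (gauss_bound x * (x\<^sup>2) ^ 1)
     + C * (gauss_bound x * (x\<^sup>2) ^ 2)" for x
  proof -
    define i where "i = inverse r"
    have i: "x / r ^ n = x * i ^ n" "x / r = x * i" for x n
      by (simp_all add: i_def field_simps)
    show ?thesis
      unfolding gauss_deriv2_bound_def A_def B_def C_def i
      by (simp add: field_simps eval_nat_numeral)
  qed
  have "(\<lambda>x. complex_of_real A * complex_of_real (gauss_bound x * (x\<^sup>2) ^ 0)
     + complex_of_real B * complex_of_real (gauss_bound x * (x\<^sup>2) ^ 1)
     + complex_of_real C * complex_of_real (gauss_bound x * (x\<^sup>2) ^ 2)) \<in> L2"
    by (intro L2_add L2_scale gauss_bound_powers_L2)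
  then show ?thesis unfolding eq of_real_add of_real_mult .
qed

lemma gauss_in_L2:
  assumes "Re z \<ge> r" "cmod z \<le> R"
  shows "gauss l z \<in> L2"
  using norm_gauss_le[OF assms] gauss_bound_nonneg
  by (intro L2_dominated(1)[OF _ gauss_bound_powers_L2[of 0]]) auto

lemma gauss_deriv_in_L2:
  assumes "Re z \<ge> r" "cmod z \<le> R"
  shows "gauss_deriv l z \<in> L2"
proof (rule L2_dominated(1))
  show "(\<lambda>x. complex_of_real (1 / (4 * r\<^sup>2)) * complex_of_real (gauss_bound x * (x\<^sup>2) ^ 1)
     + complex_of_real ((1/2 - l) / r) * complex_of_real (gauss_bound x * (x\<^sup>2) ^ 0)) \<in> L2"
    by (intro L2_add L2_scale gauss_bound_powers_L2)
  fix x :: real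
  have "cmod (gauss_deriv l z x) \<le> gauss_bound x * (x\<^sup>2 / 4 / r\<^sup>2 + (1/2 - l) / r)"
    unfolding gauss_deriv_def norm_mult
    by (intro mult_mono norm_gauss_le assms norm_gauss_deriv_aux gauss_bound_nonneg norm_ge_zero)
  also have "\<dots> = 1 / (4 * r\<^sup>2) * (gauss_bound x * (x\<^sup>2) ^ 1) + (1/2 - l) / r * (gauss_bound x * (x\<^sup>2) ^ 0)"
    using r by (simp add: field_simps)
  also have "\<dots> \<le> cmod (complex_of_real (1 / (4 * r\<^sup>2)) * complex_of_real (gauss_bound x * (x\<^sup>2) ^ 1)
     + complex_of_real ((1/2 - l) / r) * complex_of_real (gauss_bound x * (x\<^sup>2) ^ 0))"
    unfolding of_real_mult[symmetric] of_real_add[symmetric] norm_of_real by (rule abs_ge_self)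
  finally show "cmod (gauss_deriv l z x) \<le> \<dots>" .
qed simp

text \<open>The majorant depends on \<open>x\<close> alone and the times enter only through |z -
  w|^2. Taking L2 norms in \<open>x\<close> therefore turns this pointwise expansion into
  differentiability in \<open>L2\<close>.\<close>

lemma gauss_taylor:
  assumes "convex S" "\<And>z. z \<in> S \<Longrightarrow> Re z \<ge> r \<and> cmod z \<le> R" "w \<in> S" "z \<in> S"
  shows "cmod (gauss l z x - gauss l w x - (z - w) * gauss_deriv l w x) \<le> gauss_deriv2_bound x * (cmod (z - w))\<^sup>2"
proof -
  define F where "F i z = (if i = 0 then gauss l z x else if i = 1 then gauss_deriv l z x else gauss_deriv2 l z x)"
    for i :: nat and z
  have "cmod (F 0 z - (\<Sum>i\<le>1. F i w * (z - w) ^ i / (fact i))) \<le> gauss_deriv2_bound x * cmod (z - w) ^ (Suc 1) / fact 1"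
  proof (rule complex_Taylor[OF assms(1) _ _ assms(3,4)])
    fix i v assume v: "v \<in> S" and "i \<le> (1::nat)"
    then have "i = 0 \<or> i = 1" by auto
    moreover have "Re v > 0" using assms(2)[OF v] r by linarith
    ultimately show "(F i has_field_derivative F (Suc i) v) (at v within S)"
      using gauss_has_deriv[of v l x] gauss_deriv_has_deriv[of v l x]
      by (auto simp: F_def[abs_def] intro: has_field_derivative_at_within)
  next
    fix v assume "v \<in> S"
    then show "cmod (F (Suc 1) v) \<le> gauss_deriv2_bound x"
      using assms(2) by (auto simp: F_def intro: norm_gauss_deriv2_le)
  qed
  then show ?thesis by (simp add: F_def power2_eq_square algebra_simps)
qed

end

lemma gauss_L2:
  assumes "l \<in> {-1/2<..<1/2}" "Re z > 0"
  shows "gauss l z \<in> L2" "gauss_deriv l z \<in> L2"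
proof -
  have "cmod z > 0" using assms(2) by auto
  then show "gauss l z \<in> L2" "gauss_deriv l z \<in> L2"
    using assms gauss_in_L2[of l "Re z" "cmod z" z] gauss_deriv_in_L2[of l "Re z" "cmod z" z] by auto
qed

lemma gauss_has_L2_derivative:
  assumes l: "l \<in> {-1/2<..<1/2}" and z: "Re z > 0"
  shows "((\<lambda>h. L2norm (\<lambda>x. (gauss l (z + \<i> * complex_of_real h) x - gauss l z x) / complex_of_real h
     - \<i> * gauss_deriv l z x)) \<longlongrightarrow> 0) (at 0)"
proof (rule Lim_null_comparison)
  \<comment> \<open>The closed ball of radius Re z / 2 around \<open>z\<close> stays in Re w \<ge> r
    and |w| \<le> R, where one majorant serves all points.\<close>
  define r R where "r = Re z / 2" and "R = cmod z + r"
  have rR: "r > 0" "R > 0" using z by (auto simp: r_def R_def intro: add_nonneg_pos)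
  define M where "M x = gauss_deriv2_bound l r R x" for x
  have M: "(\<lambda>x. complex_of_real (M x)) \<in> L2" unfolding M_def by (rule gauss_deriv2_bound_L2[OF l rR])
  define S where "S = cball z r"
  have S: "Re w \<ge> r \<and> cmod w \<le> R" if "w \<in> S" for w
  proof
    have d: "cmod (z - w) \<le> r" using that by (simp add: S_def dist_norm)
    show "Re w \<ge> r" using abs_Re_le_cmod[of "z - w"] d by (simp add: r_def)
    show "cmod w \<le> R" using norm_triangle_ineq4[of z "z - w"] d by (simp add: R_def)
  qed
  show "\<forall>\<^sub>F h in at 0. norm (L2norm (\<lambda>x. (gauss l (z + \<i> * complex_of_real h) x - gauss l z x) / complex_of_real h
     - \<i> * gauss_deriv l z x)) \<le> \<bar>h\<bar> * L2norm (\<lambda>x. complex_of_real (M x))"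
    unfolding eventually_at
  proof (intro exI[of _ r] conjI rR ballI impI)
    fix h :: real assume h: "h \<noteq> 0 \<and> dist h 0 < r"
    define w where "w = z + \<i> * complex_of_real h"
    have w: "w \<in> S" "z \<in> S" "cmod (w - z) = \<bar>h\<bar>" "w - z = \<i> * complex_of_real h"
      using h rR by (auto simp: w_def S_def dist_norm norm_mult)
    have "L2norm (\<lambda>x. (gauss l w x - gauss l z x) / complex_of_real h - \<i> * gauss_deriv l z x)
      \<le> L2norm (\<lambda>x. complex_of_real h * complex_of_real (M x))"
    proof (rule L2_dominated(2)[OF _ L2_scale[OF M]])
      fix x :: real
      have "(gauss l w x - gauss l z x) / complex_of_real h - \<i> * gauss_deriv l z x =
        (gauss l w x - gauss l z x - (w - z) * gauss_deriv l z x) / complex_of_real h"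
        using h by (simp add: w(4) diff_divide_distrib)
      also have "cmod \<dots> \<le> M x * (cmod (w - z))\<^sup>2 / \<bar>h\<bar>"
        unfolding norm_divide norm_of_real M_def using S w
        by (intro divide_right_mono gauss_taylor[OF l rR, of S]) (auto simp: S_def)
      also have "\<dots> = M x * \<bar>h\<bar>" unfolding w(3) using h by (cases "h > 0") (auto simp: power2_eq_square)
      also have "\<dots> \<le> cmod (complex_of_real h * complex_of_real (M x))"
        by (simp add: norm_mult mult.commute mult_left_mono)
      finally show "cmod ((gauss l w x - gauss l z x) / complex_of_real h - \<i> * gauss_deriv l z x) \<le> \<dots>" .
    qed measurable
    then show "norm (L2norm (\<lambda>x. (gauss l (z + \<i> * complex_of_real h) x - gauss l z x) / complex_of_real h
     - \<i> * gauss_deriv l z x)) \<le> \<bar>h\<bar> * L2norm (\<lambda>x. complex_of_real (M x))"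
      by (simp add: w_def L2norm_scale L2norm_nonneg)
  qed
  show "((\<lambda>h. \<bar>h\<bar> * L2norm (\<lambda>x. complex_of_real (M x))) \<longlongrightarrow> 0) (at 0)"
    by (auto intro!: tendsto_eq_intros)
qed

section \<open>The evolution of Gaussians and the lower bound\<close>

definition gauss_logderiv :: "real \<Rightarrow> complex \<Rightarrow> real \<Rightarrow> complex" where
  "gauss_logderiv l z x = - (complex_of_real l / complex_of_real x) - complex_of_real x / (2 * z)"

lemma gauss_has_vector_derivative:
  assumes x: "x > 0" and z: "z \<noteq> 0"
  shows "(gauss l z has_vector_derivative gauss l z x * gauss_logderiv l z x) (at x)"
proof -
  define c where "c = z powr (- complex_of_real (1/2 - l))"
  define s where "s = - complex_of_real l"
  \<comment> \<open>A holomorphic extension in the space variable makes the complex differentiation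
    rules available; it agrees with \<open>gauss\<close> on the positive axis, hence the local
    transfer at the end.\<close>
  define F where "F w = w powr s * c * exp (- (w\<^sup>2 / 4 / z))" for w
  define X where "X = complex_of_real x"
  have X: "X \<notin> \<real>\<^sub>\<le>\<^sub>0" "X \<noteq> 0" using x by (auto simp: X_def)
  have 1: "((\<lambda>w. w powr s) has_field_derivative s * (X powr s / X)) (at X)"
    using has_field_derivative_powr[OF X(1), of s] X by (simp add: powr_diff)
  have 2: "((\<lambda>w. exp (- (w\<^sup>2 / 4 / z))) has_field_derivative exp (- (X\<^sup>2 / 4 / z)) * (- (X / (2 * z)))) (at X)"
    using z by (auto intro!: derivative_eq_intros)
  have "(F has_field_derivative F X * (s / X - X / (2 * z))) (at X)"
    using DERIV_mult[OF DERIV_cmult_right[OF 1, of c] 2] unfolding F_def by (simp add: algebra_simps)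
  then have "((\<lambda>x. F (complex_of_real x)) has_vector_derivative F X * (s / X - X / (2 * z))) (at x)"
    unfolding X_def by (rule has_vector_derivative_real_field)
  moreover have FG: "F (complex_of_real y) = gauss l z y" if "y > 0" for y
    using that powr_of_real[of y "- l"] by (simp add: F_def gauss_def s_def c_def)
  moreover have "F X * (s / X - X / (2 * z)) = gauss l z x * gauss_logderiv l z x"
    unfolding X_def FG[OF x] gauss_logderiv_def s_def by simp
  ultimately have "((\<lambda>x. F (complex_of_real x)) has_vector_derivative gauss l z x * gauss_logderiv l z x) (at x)"
    by simp
  then show ?thesis
    by (rule has_vector_derivative_transform_within_open[where S = "{0<..}"]) (use x FG in auto)
qed

lemma gauss_logderiv_has_vector_derivative:
  assumes x: "x > 0" and z: "z \<noteq> 0"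
  shows "(gauss_logderiv l z has_vector_derivative
    complex_of_real l / complex_of_real x ^ 2 - 1 / (2 * z)) (at x)"
  unfolding gauss_logderiv_def
  by (rule has_vector_derivative_real_field)
    (use x z in \<open>auto intro!: derivative_eq_intros simp: power2_eq_square\<close>)

definition gauss_dxx :: "real \<Rightarrow> complex \<Rightarrow> real \<Rightarrow> complex" where
  "gauss_dxx l z x = gauss l z x * ((gauss_logderiv l z x)\<^sup>2 +
     (complex_of_real l / complex_of_real x ^ 2 - 1 / (2 * z)))"

lemma D_gauss:
  assumes "x > 0" "z \<noteq> 0"
  shows "D (gauss l z) x = gauss l z x * gauss_logderiv l z x"
  unfolding D_def by (intro vector_derivative_at gauss_has_vector_derivative assms)

lemma D_gauss_has_vector_derivative:
  assumes x: "x > 0" and z: "z \<noteq> 0"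
  shows "(D (gauss l z) has_vector_derivative gauss_dxx l z x) (at x)"
proof -
  have "((\<lambda>x. gauss l z x * gauss_logderiv l z x) has_vector_derivative gauss_dxx l z x) (at x)"
    using has_vector_derivative_mult[OF gauss_has_vector_derivative[OF assms, of l]
        gauss_logderiv_has_vector_derivative[OF assms, of l]]
    by (simp add: gauss_dxx_def algebra_simps power2_eq_square)
  then show ?thesis
    by (rule has_vector_derivative_transform_within_open[where S = "{0<..}"]) (use x z in \<open>auto simp: D_gauss\<close>)
qed

text \<open>Since x^(-l) solves \<open>tau l u = 0\<close>, the terms l^2 / x^2 and l / x^2 of the
  second derivative cancel the potential; what remains is minus the logarithmic derivative in
  \<open>z\<close>.\<close>

lemma tau_gauss:
  assumes x: "x > 0" and z: "z \<noteq> 0"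
  shows "tau l (gauss l z) x = - gauss_deriv l z x"
proof -
  define X L where "X = complex_of_real x" and "L = complex_of_real l"
  have X: "X \<noteq> 0" using x by (simp add: X_def)
  have D: "D (D (gauss l z)) x = gauss_dxx l z x"
    unfolding D_def[of "D (gauss l z)"] by (intro vector_derivative_at D_gauss_has_vector_derivative assms)
  have "- ((- (L / X) - X / (2 * z))\<^sup>2 + (L / X\<^sup>2 - 1 / (2 * z))) + L * (L + 1) / X\<^sup>2 =
    - (X\<^sup>2 / 4 / z\<^sup>2 - (1 / 2 - L) / z)"
    using X z by (simp add: field_simps power2_eq_square)
  moreover have "tau l (gauss l z) x = gauss l z x *
    (- ((- (L / X) - X / (2 * z))\<^sup>2 + (L / X\<^sup>2 - 1 / (2 * z))) + L * (L + 1) / X\<^sup>2)"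
    unfolding tau_def D gauss_dxx_def gauss_logderiv_def X_def L_def by (simp add: algebra_simps)
  moreover have "gauss_deriv l z x = gauss l z x * (X\<^sup>2 / 4 / z\<^sup>2 - (1 / 2 - L) / z)"
    unfolding gauss_deriv_def X_def L_def by simp
  ultimately show ?thesis by (simp only: mult_minus_right)
qed

text \<open>The common factor x^(-l) has zero Wronskian with itself, so only the derivative of the
  exponential contributes. The result is O(x^(1 - 2 l)), which vanishes at 0 because l <
  1/2.\<close>

lemma Gamma1_gauss:
  assumes l: "l \<in> {-1/2<..<1/2}" and z: "Re z > 0"
  shows "Gamma1 l (gauss l z) = 0"
proof -
  have z0: "z \<noteq> 0" using z by auto
  define K where "K = Re z powr (- (1/2 - l)) * (1 / (2 * cmod z))"
  have W: "Wronskian (gauss l z) (\<lambda>x. complex_of_real (x powr (- l))) x =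
    gauss l z x * complex_of_real (x powr (1 - l)) / (2 * z)" if x: "x > 0" for x
  proof -
    have "((\<lambda>x. complex_of_real (x powr (- l))) has_vector_derivative complex_of_real (- l * x powr (- l) / x)) (at x)"
      using x by (auto intro!: has_vector_derivative_of_real derivative_eq_intros
          simp: powr_diff simp flip: has_real_derivative_iff_has_vector_derivative)
    then have "D (\<lambda>x. complex_of_real (x powr (- l))) x = complex_of_real (- l * x powr (- l) / x)"
      unfolding D_def by (rule vector_derivative_at)
    moreover have "x powr (1 - l) = x * x powr (- l)" using x powr_add[of x 1 "- l"] by simp
    ultimately show ?thesis
      unfolding Wronskian_def using x z0
      by (simp add: D_gauss gauss_logderiv_def algebra_simps)
  qed
  have bnd: "cmod (Wronskian (gauss l z) (\<lambda>x. complex_of_real (x powr (- l))) x) \<le> K * x powr (1 - 2 * l)"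
    if x: "x > 0" for x
  proof -
    have "cmod (gauss l z x) \<le> gauss_bound l (Re z) (cmod z) x"
      using l z z0 by (intro norm_gauss_le) auto
    also have "\<dots> \<le> x powr (- l) * Re z powr (- (1/2 - l)) * 1"
    proof -
      have "gauss_bound l (Re z) (cmod z) x = x powr (- l) * Re z powr (- (1/2 - l)) * exp (- (Re z / (4 * (cmod z)\<^sup>2)) * x\<^sup>2)"
        using l z z0 by (intro gauss_bound_def) auto
      then show ?thesis using z by (auto simp del: mult_1_right intro!: mult_left_mono)
    qed
    finally have "cmod (gauss l z x) * x powr (1 - l) * (1 / (2 * cmod z))
      \<le> x powr (- l) * Re z powr (- (1/2 - l)) * x powr (1 - l) * (1 / (2 * cmod z))"
      by (intro mult_right_mono) auto
    also have "\<dots> = K * (x powr (- l) * x powr (1 - l))" by (simp add: K_def)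
    also have "x powr (- l) * x powr (1 - l) = x powr (1 - 2 * l)" by (simp flip: powr_add)
    finally show ?thesis using x by (simp add: W norm_mult norm_divide)
  qed
  have "(Wronskian (gauss l z) (\<lambda>x. complex_of_real (x powr (- l))) \<longlongrightarrow> 0) (at_right 0)"
  proof (rule Lim_null_comparison)
    show "\<forall>\<^sub>F x in at_right 0. cmod (Wronskian (gauss l z) (\<lambda>x. complex_of_real (x powr (- l))) x) \<le> K * x powr (1 - 2 * l)"
      using eventually_at_right_less[of 0] by eventually_elim (rule bnd)
    have "((\<lambda>x::real. x powr (1 - 2 * l)) \<longlongrightarrow> 0) (at_right 0)"
      using l by (intro tendsto_zero_powrI[OF _ tendsto_const]) (auto simp: eventually_at_filter)
    then show "((\<lambda>x. K * x powr (1 - 2 * l)) \<longlongrightarrow> 0) (at_right 0)"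
      by (rule tendsto_mult_right_zero)
  qed
  then have "Lim (at_right 0) (Wronskian (gauss l z) (\<lambda>x. complex_of_real (x powr (- l)))) = 0"
    by (intro tendsto_Lim) auto
  then show ?thesis by (simp add: Gamma1_def)
qed

lemma gauss_in_H_graph:
  assumes l: "l \<in> {-1/2<..<1/2}" and z: "Re z > 0"
  shows "(gauss l z, \<lambda>x. - gauss_deriv l z x) \<in> H_graph l (pi / 2)"
proof -
  have z0: "z \<noteq> 0" using z by auto
  note L2 = gauss_L2[OF assms]
  have m: "(\<lambda>x. - gauss_deriv l z x) \<in> L2" using L2_scale[OF L2(2), of "-1"] by simp
  have "tau l (gauss l z) \<in> L2"
  proof (rule L2_dominated(1)[OF _ m])
    show "tau l (gauss l z) \<in> borel_measurable half_line"
      using m unfolding L2_def by (subst measurable_cong[of _ _ "\<lambda>x. - gauss_deriv l z x"]) (auto simp: tau_gauss z0)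
  qed (simp add: tau_gauss z0)
  moreover have c1: "continuous_on {0<..} (gauss l z)"
    using gauss_has_vector_derivative[OF _ z0]
    by (auto intro!: continuous_at_imp_continuous_on has_vector_derivative_continuous)
  moreover have "continuous_on {0<..} (gauss_logderiv l z)"
    using gauss_logderiv_has_vector_derivative[OF _ z0]
    by (auto intro!: continuous_at_imp_continuous_on has_vector_derivative_continuous)
  ultimately have dom: "gauss l z \<in> dom_Hmax l"
    unfolding dom_Hmax_def using gauss_has_vector_derivative[OF _ z0] D_gauss_has_vector_derivative[OF _ z0] L2
    by (auto simp: gauss_dxx_def[abs_def] z0
        intro!: differentiableI_vector C1_imp_locally_abs_continuous[of _ "\<lambda>x. gauss l z x * gauss_logderiv l z x"]
          C1_imp_locally_abs_continuous[of "D (gauss l z)" "gauss_dxx l z"] continuous_intros)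
  then have "gauss l z \<in> dom_H l (pi / 2)"
    by (simp add: dom_H_def Gamma1_gauss[OF assms])
  then show ?thesis
    using L2 m z0 unfolding H_graph_def ae_eq_def
    by (auto intro!: bexI[of _ "gauss l z"] AE_half_lineI simp: tau_gauss)
qed

text \<open>The vertical line z + i s keeps its real part, so domain membership and L2
  differentiability hold at all times of both signs. Along it d/ds = i d/dz, which together with H =
  -d/dz is the Schroedinger equation.\<close>

lemma gauss_evolution:
  assumes l: "l \<in> {-1/2<..<1/2}" and U: "is_exp_group (H_graph l (pi / 2)) U" and z: "Re z > 0"
  shows "ae_eq (U t (gauss l z)) (gauss l (z + \<i> * complex_of_real t))"
proof -
  have Re: "Re (z + \<i> * complex_of_real s) > 0" for s using z by simp
  have "ae_eq (U t ((\<lambda>s. gauss l (z + \<i> * complex_of_real s)) 0)) ((\<lambda>s. gauss l (z + \<i> * complex_of_real s)) t)"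
  proof (rule exp_group_unique_solution[OF U, where g = "\<lambda>s x. - gauss_deriv l (z + \<i> * complex_of_real s) x"])
    fix s
    show "gauss l (z + \<i> * complex_of_real s) \<in> L2" by (rule gauss_L2[OF l Re])
    show "(\<lambda>x. - gauss_deriv l (z + \<i> * complex_of_real s) x) \<in> L2"
      using L2_scale[OF gauss_L2(2)[OF l Re], of "-1"] by simp
    show "(gauss l (z + \<i> * complex_of_real s), \<lambda>x. - gauss_deriv l (z + \<i> * complex_of_real s) x) \<in> H_graph l (pi / 2)"
      by (rule gauss_in_H_graph[OF l Re])
    show "((\<lambda>h. L2norm (\<lambda>x. (gauss l (z + \<i> * complex_of_real (s + h)) x - gauss l (z + \<i> * complex_of_real s) x) / complex_of_real h
        - - \<i> * - gauss_deriv l (z + \<i> * complex_of_real s) x)) \<longlongrightarrow> 0) (at 0)"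
      using gauss_has_L2_derivative[OF l Re, of s] by (simp add: algebra_simps)
  qed
  then show ?thesis by simp
qed


section \<open>Sharpness from a single Gaussian\<close>

lemma AE_half_line_ex:
  assumes "AE x in half_line. P x"
  shows "\<exists>x\<in>{0<..<1}. P x"
proof (rule ccontr)
  assume "\<not> ?thesis"
  moreover have "AE x in lborel. x \<in> {0<..} \<longrightarrow> P x"
    using assms unfolding half_line_def by (subst (asm) AE_restrict_space_iff) auto
  ultimately have "AE x in lborel. x \<notin> {0<..<1::real}"
    by (auto elim!: AE_mp)
  then have "emeasure lborel {0<..<1::real} = 0"
    by (subst (asm) AE_iff_measurable[of "{0<..<1}"]) auto
  then show False by simp
qed

lemma norm_complex_powr_real:
  "cmod (z powr complex_of_real s) = cmod z powr s"
  by (subst norm_powr_real_powr') auto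

text \<open>An essential supremum is bounded below by values on a set of positive measure. The
  interval (0,1) is chosen because for l > 0 the weight min(x^l, 1) is x^l there and cancels the
  singularity of the Gaussian.\<close>

lemma Linfnorm_ge:
  assumes "\<And>x. 0 < x \<Longrightarrow> x < 1 \<Longrightarrow> c \<le> cmod (g x) * w x" and "ae_eq f g"
  shows "ennreal c \<le> Linfnorm w f"
proof -
  have "AE x in half_line. f x = g x \<and> ennreal (cmod (f x) * w x) \<le> Linfnorm w f"
    using assms(2) esssup_AE[where M = half_line and f = "\<lambda>x. ennreal (cmod (f x) * w x)"]
    unfolding ae_eq_def Linfnorm_def by eventually_elim simp
  from AE_half_line_ex[OF this] obtain x where "0 < x" "x < 1" "f x = g x"
    "ennreal (cmod (f x) * w x) \<le> Linfnorm w f" by auto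
  then show ?thesis using assms(1)[of x] by (auto intro: order_trans ennreal_leI)
qed

lemma L1norm_scale:
  assumes "f \<in> borel_measurable half_line" "w \<in> borel_measurable half_line"
  shows "L1norm w (\<lambda>x. complex_of_real c * f x) = ennreal \<bar>c\<bar> * L1norm w f"
proof -
  note [measurable] = assms
  have "L1norm w (\<lambda>x. complex_of_real c * f x) = (\<integral>\<^sup>+x. ennreal \<bar>c\<bar> * ennreal (cmod (f x) * w x) \<partial>half_line)"
    unfolding L1norm_def by (intro nn_integral_cong) (simp add: norm_mult ennreal_mult'' mult.assoc flip: ennreal_mult')
  then show ?thesis unfolding L1norm_def by (subst (asm) nn_integral_cmult) auto
qed

text \<open>For l > 0 the weight doubles the singularity at 0 to x^(-2 l), still integrable because
  l < 1/2.\<close>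

lemma gauss_L1norm_finite:
  assumes l: "l \<in> {-1/2<..<1/2}"
  shows "L1norm (\<lambda>x. max (x powr (- l)) 1) (gauss l 1) < \<infinity>"
proof -
  have 1: "integrable half_line (\<lambda>x. x powr (- 2 * l) * exp (- (1/4) * x\<^sup>2) + x powr (- l) * exp (- (1/4) * x\<^sup>2))"
    using l by (intro Bochner_Integration.integrable_add gaussian_moment_integrable) auto
  have "L1norm (\<lambda>x. max (x powr (- l)) 1) (gauss l 1) \<le>
     (\<integral>\<^sup>+x. ennreal (x powr (- 2 * l) * exp (- (1/4) * x\<^sup>2) + x powr (- l) * exp (- (1/4) * x\<^sup>2)) \<partial>half_line)"
    unfolding L1norm_def
  proof (intro nn_integral_mono ennreal_leI)
    fix x :: real
    define e where "e = x powr (- l) * exp (- (1/4) * x\<^sup>2)"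
    have "cmod (gauss l 1 x) = e" by (simp add: gauss_def norm_mult e_def)
    moreover have "e \<ge> 0" by (simp add: e_def)
    then have "e * max (x powr (- l)) 1 \<le> e * (x powr (- l) + 1)" by (intro mult_left_mono) auto
    moreover have "x powr (- 2 * l) = x powr (- l) * x powr (- l)" by (simp flip: powr_add)
    ultimately show "cmod (gauss l 1 x) * max (x powr - l) 1 \<le>
      x powr (- 2 * l) * exp (- (1/4) * x\<^sup>2) + x powr (- l) * exp (- (1/4) * x\<^sup>2)"
      unfolding e_def by (simp add: algebra_simps)
  qed
  also have "\<dots> < \<infinity>"
    using integrableD(2)[OF 1] by (simp add: less_top)
  finally show ?thesis .
qed

text \<open>At z = 1 + i t the time factor is |z|^(-1/2 + l) with |z| \<le> 2 t. Since |z| \<ge> 1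
  gives Re (1/z) \<le> 1, the exponential stays above exp(-1/4) for x < 1. The factor 2^(-1/2 + l)
  is lowered to 2^(-1/2) to make the constant independent of \<open>l\<close>.\<close>

lemma gauss_lower_bound:
  assumes t: "t \<ge> 1" and x: "0 < x" "x < 1" and l: "0 < l" "l < 1/2"
  shows "2 powr (- 1/2) * exp (- 1/4) * t powr (- 1/2 + l) \<le> cmod (gauss l (1 + \<i> * complex_of_real t) x) * min (x powr l) 1"
proof -
  define z where "z = 1 + \<i> * complex_of_real t"
  have "cmod z \<le> 1 + \<bar>t\<bar>" unfolding z_def using norm_triangle_ineq[of 1 "\<i> * complex_of_real t"] by (simp add: norm_mult)
  then have zt: "cmod z \<le> 2 * t" using t by simp
  have z1: "cmod z \<ge> 1" using complex_Re_le_cmod[of z] by (simp add: z_def)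
  have Re1: "Re (1 / z) \<le> 1"
  proof -
    have "Re (1 / z) \<le> cmod (1 / z)" by (rule complex_Re_le_cmod)
    also have "\<dots> \<le> 1" using z1 by (simp add: norm_divide divide_le_eq)
    finally show ?thesis .
  qed
  have Re: "Re (complex_of_real a / z) = a * Re (1 / z)" for a
    by (simp add: Re_divide)
  have "x\<^sup>2 / 4 * Re (1 / z) \<le> 1 / 4 * 1"
    using x Re1 by (intro order_trans[OF mult_left_mono[OF Re1]]) (auto simp: power_le_one)
  then have e: "exp (- 1/4) \<le> cmod (exp (- (complex_of_real (x\<^sup>2 / 4) / z)))"
    unfolding norm_exp_eq_Re uminus_complex.sel Re by simp
  have "2 powr (- 1/2) * t powr (- 1/2 + l) \<le> 2 powr (- 1/2 + l) * t powr (- 1/2 + l)"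
    using l by (intro mult_right_mono) auto
  also have "\<dots> = (2 * t) powr (- 1/2 + l)" using t by (simp add: powr_mult)
  also have "\<dots> \<le> cmod z powr (- 1/2 + l)" using zt z1 l by (intro powr_mono2') auto
  also have "\<dots> = cmod (z powr (- complex_of_real (1/2 - l)))"
    unfolding of_real_minus[symmetric] norm_complex_powr_real by simp
  finally have p: "2 powr (- 1/2) * t powr (- 1/2 + l) \<le> cmod (z powr (- complex_of_real (1/2 - l)))" .
  have m: "min (x powr l) 1 = x powr l" using x l by (intro min_absorb1) (simp add: powr_le1)
  have xx: "x powr (- l) * x powr l = 1" using x by (simp flip: powr_add)
  have "2 powr (- 1/2) * exp (- 1/4) * t powr (- 1/2 + l) = (2 powr (- 1/2) * t powr (- 1/2 + l)) * exp (- 1/4)"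
    by simp
  also have "\<dots> \<le> cmod (z powr (- complex_of_real (1/2 - l))) * cmod (exp (- (complex_of_real (x\<^sup>2 / 4) / z)))"
    by (intro mult_mono p e) auto
  also have "\<dots> = cmod (gauss l z x) * min (x powr l) 1"
    unfolding m gauss_def norm_mult norm_of_real using xx by (simp add: mult_ac)
  finally show ?thesis by (simp add: z_def)
qed

lemma dispersive_lower_bound:
  assumes l: "l \<in> {0<..<1/2}" and U: "is_exp_group (H_graph l (pi / 2)) U"
  shows "\<exists>c>0. \<exists>t0>0. \<forall>t\<ge>t0. ennreal (c * \<bar>t\<bar> powr (- 1/2 + l))
                \<le> norm_L1_Linf (\<lambda>x. max (x powr (- l)) 1) (\<lambda>x. min (x powr l) 1) (U t)"
proof -
  have l': "l \<in> {-1/2<..<1/2}" using l by auto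
  have G: "gauss l 1 \<in> L2" by (rule gauss_L2[OF l']) simp
  have UG: "unitary_group U" using U by (simp add: is_exp_group_def)
  obtain N where N: "N \<ge> 0" "L1norm (\<lambda>x. max (x powr (- l)) 1) (gauss l 1) = ennreal N"
    using gauss_L1norm_finite[OF l'] by (cases "L1norm (\<lambda>x. max (x powr (- l)) 1) (gauss l 1)") auto
  \<comment> \<open>Normalizes the datum to weighted L1 norm at most 1; the added 1 makes the
    quotient meaningful for any N \<ge> 0.\<close>
  define k where "k = 1 / (N + 1)"
  have k: "k > 0" "k * N \<le> 1" using N by (auto simp: k_def field_simps)
  define f where "f x = complex_of_real k * gauss l 1 x" for x
  have f: "f \<in> L2" unfolding f_def by (intro L2_scale G)
  have "L1norm (\<lambda>x. max (x powr (- l)) 1) f \<le> 1"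
    unfolding f_def using N k by (subst L1norm_scale) (auto simp flip: ennreal_mult)
  then have fm: "Linfnorm (\<lambda>x. min (x powr l) 1) (U t f) \<le>
    norm_L1_Linf (\<lambda>x. max (x powr (- l)) 1) (\<lambda>x. min (x powr l) 1) (U t)" for t
    unfolding norm_L1_Linf_def using f by (intro SUP_upper) auto
  have Uf: "ae_eq (U t f) (\<lambda>x. complex_of_real k * gauss l (1 + \<i> * complex_of_real t) x)" for t
  proof -
    have "ae_eq (U t (\<lambda>x. complex_of_real k * gauss l 1 x + 0 * gauss l 1 x))
      (\<lambda>x. complex_of_real k * U t (gauss l 1) x + 0 * U t (gauss l 1) x)"
      by (rule unitary_groupD(3)[OF UG G G])
    moreover have "ae_eq (U t (gauss l 1)) (gauss l (1 + \<i> * complex_of_real t))"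
      by (rule gauss_evolution[OF l' U]) simp
    ultimately show ?thesis
      unfolding f_def[abs_def] ae_eq_def by eventually_elim simp
  qed
  show ?thesis
  proof (intro exI conjI allI impI)
    show "k * (2 powr (- 1/2) * exp (- 1/4)) > 0" "(1::real) > 0" using k by auto
    fix t :: real assume t: "t \<ge> 1"
    have "ennreal (k * (2 powr (- 1/2) * exp (- 1/4)) * \<bar>t\<bar> powr (- 1/2 + l)) \<le> Linfnorm (\<lambda>x. min (x powr l) 1) (U t f)"
    proof (rule Linfnorm_ge[OF _ Uf])
      fix x :: real assume x: "0 < x" "x < 1"
      have "k * (2 powr (- 1/2) * exp (- 1/4) * t powr (- 1/2 + l)) \<le>
        k * (cmod (gauss l (1 + \<i> * complex_of_real t) x) * min (x powr l) 1)"
        using k l by (intro mult_left_mono gauss_lower_bound t x) auto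
      then show "k * (2 powr (- 1/2) * exp (- 1/4)) * \<bar>t\<bar> powr (- 1/2 + l) \<le>
        cmod (complex_of_real k * gauss l (1 + \<i> * complex_of_real t) x) * min (x powr l) 1"
        using t k by (simp add: norm_mult mult.assoc)
    qed
    also note fm
    finally show "ennreal (k * (2 powr (- 1/2) * exp (- 1/4)) * \<bar>t\<bar> powr (- 1/2 + l)) \<le>
      norm_L1_Linf (\<lambda>x. max (x powr (- l)) 1) (\<lambda>x. min (x powr l) 1) (U t)" .
  qed
qed

section \<open>The Bessel kernel\<close>

context
  fixes l :: real
  assumes l: "l \<in> {-1/2<..<1/2}"
begin

text \<open>Taylor coefficients in q = z^2 / 4 of (z/2)^(-nu) J_nu(z), where nu + 1 = 1/2 - l. As a
  function of q this is entire, so the fractional power stays outside the series.\<close>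

definition bcoeff :: "nat \<Rightarrow> real" where
  "bcoeff k = (- 1) ^ k / (fact k * Gamma (real k + (1/2 - l)))"

definition bseries :: "real \<Rightarrow> real" where
  "bseries q = (\<Sum>k. bcoeff k * q ^ k)"

text \<open>Passing from k to k + 1 multiplies by k + p with p = 1/2 - l in (0,1): a factor below 1
  at k = 0 and at least 1 afterwards, so the minimum sits at k = 1. This positive lower bound lets
  an exponential series dominate \<open>bseries\<close>.\<close>

lemma Gamma_shift_ge: "Gamma (1 + (1/2 - l)) \<le> Gamma (real k + (1/2 - l))"
proof -
  define p where "p = 1/2 - l"
  have p: "0 < p" "p < 1" using l by (auto simp: p_def)
  have rec: "Gamma (real (Suc k) + p) = (real k + p) * Gamma (real k + p)" for k
    using Gamma_plus1[of "real k + p"] p by (simp add: add_ac nonpos_Ints_def)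
  have "Gamma (1 + p) \<le> Gamma (real k + p)"
  proof (induction k)
    case 0
    have "p * Gamma p \<le> 1 * Gamma p" using p by (intro mult_right_mono) (auto intro: Gamma_real_nonneg)
    then show ?case using rec[of 0] by simp
  next
    case (Suc k)
    show ?case
    proof (cases k)
      case (Suc m)
      have "1 * Gamma (real k + p) \<le> (real k + p) * Gamma (real k + p)"
        using p Suc by (intro mult_right_mono Gamma_real_nonneg) auto
      then show ?thesis using Suc.IH rec[of k] by linarith
    qed simp
  qed
  then show ?thesis by (simp add: p_def)
qed

lemma bseries_summable_norm: "summable (\<lambda>k. norm (bcoeff k * q ^ k))"
proof (rule summable_comparison_test')
  define m where "m = Gamma (1 + (1/2 - l))"
  have m: "m > 0" unfolding m_def using l by (intro Gamma_real_pos) auto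
  show "summable (\<lambda>k. 1 / m * (\<bar>q\<bar> ^ k /\<^sub>R fact k))"
    by (intro summable_mult summable_exp_generic)
  fix k :: nat
  have g: "m \<le> Gamma (real k + (1/2 - l))" unfolding m_def by (rule Gamma_shift_ge)
  have "1 / (fact k * Gamma (real k + (1/2 - l))) \<le> 1 / (fact k * m)"
    using g m by (intro divide_left_mono mult_left_mono mult_pos_pos) auto
  then have "1 / (fact k * Gamma (real k + (1/2 - l))) * \<bar>q\<bar> ^ k \<le> 1 / (fact k * m) * \<bar>q\<bar> ^ k"
    by (intro mult_right_mono) auto
  then show "norm (norm (bcoeff k * q ^ k)) \<le> 1 / m * (\<bar>q\<bar> ^ k /\<^sub>R fact k)"
    using g m by (simp add: bcoeff_def abs_mult power_abs field_simps)
qed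

lemma bseries_summable: "summable (\<lambda>k. bcoeff k * q ^ k)"
  using bseries_summable_norm by (rule summable_norm_cancel)

definition bseries' :: "real \<Rightarrow> real" where "bseries' q = (\<Sum>k. diffs bcoeff k * q ^ k)"
definition bseries'' :: "real \<Rightarrow> real" where "bseries'' q = (\<Sum>k. diffs (diffs bcoeff) k * q ^ k)"

lemma bseries'_summable: "summable (\<lambda>k. diffs bcoeff k * q ^ k)"
  using bseries_summable by (rule termdiff_converges_all)

lemma bseries''_summable: "summable (\<lambda>k. diffs (diffs bcoeff) k * q ^ k)"
  using bseries'_summable by (rule termdiff_converges_all)

lemma DERIV_bseries: "(bseries has_field_derivative bseries' q) (at q)"
  unfolding bseries_def[abs_def] bseries'_def
  by (rule termdiffs_strong_converges_everywhere[OF bseries_summable])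

lemma DERIV_bseries': "(bseries' has_field_derivative bseries'' q) (at q)"
  unfolding bseries'_def[abs_def] bseries''_def
  by (rule termdiffs_strong_converges_everywhere[OF bseries'_summable])

text \<open>Bessel's equation in the variable q. By the functional equation of Gamma, the
  coefficients satisfy (n + p) (n + 1) b_(n+1) = -b_n.\<close>

lemma bseries_ode: "q * bseries'' q + (1/2 - l) * bseries' q + bseries q = 0"
proof -
  define p where "p = 1/2 - l"
  have p: "0 < p" using l by (auto simp: p_def)
  have "(\<lambda>n. q * (diffs (diffs bcoeff) n * q ^ n)) sums (q * bseries'' q)"
    unfolding bseries''_def by (intro sums_mult summable_sums bseries''_summable)
  \<comment> \<open>Multiplication by q shifts the index by one; the term restored at n = 0 carries
    the factor 0.\<close>
  then have "(\<lambda>n. (\<lambda>n. real n * diffs bcoeff n * q ^ n) (Suc n)) sums (q * bseries'' q)"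
    by (simp add: diffs_def mult_ac)
  then have 1: "(\<lambda>n. real n * diffs bcoeff n * q ^ n) sums (q * bseries'' q)"
    by (subst (asm) sums_Suc_iff) simp
  have 2: "(\<lambda>n. p * (diffs bcoeff n * q ^ n)) sums (p * bseries' q)"
    unfolding bseries'_def by (intro sums_mult summable_sums bseries'_summable)
  have 3: "(\<lambda>n. bcoeff n * q ^ n) sums (bseries q)"
    unfolding bseries_def by (intro summable_sums bseries_summable)
  have z: "(real n + p) * diffs bcoeff n + bcoeff n = 0" for n
  proof -
    have rec: "Gamma (real (Suc n) + p) = (real n + p) * Gamma (real n + p)"
      using Gamma_plus1[of "real n + p"] p by (simp add: add_ac nonpos_Ints_def)
    have bc: "bcoeff k = (- 1) ^ k / (fact k * Gamma (real k + p))" for k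
      by (simp only: bcoeff_def p_def)
    have "Gamma (real n + p) > 0" "real n + p > 0" using p by (auto intro: Gamma_real_pos)
    then show ?thesis
      unfolding diffs_def bc[of "Suc n"] bc[of n] rec by (simp add: divide_simps)
  qed
  have "(\<lambda>n. real n * diffs bcoeff n * q ^ n + p * (diffs bcoeff n * q ^ n) + bcoeff n * q ^ n) =
     (\<lambda>n. ((real n + p) * diffs bcoeff n + bcoeff n) * q ^ n)"
    by (simp add: algebra_simps)
  also have "\<dots> = (\<lambda>n. 0)" unfolding z by simp
  finally have "(\<lambda>n. 0) sums (q * bseries'' q + p * bseries' q + bseries q)"
    using sums_add[OF sums_add[OF 1 2] 3] by simp
  then show ?thesis using sums_unique2[OF sums_zero] by (simp add: p_def)
qed

text \<open>Up to a power of \<open>z\<close> this is the Bessel function of order \<open>-(l + 1/2)\<close>.\<close>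

definition bessel :: "real \<Rightarrow> real" where "bessel z = bseries (z\<^sup>2 / 4)"

lemma continuous_bessel: "continuous_on UNIV bessel"
proof -
  have "continuous_on UNIV bseries"
    using DERIV_bseries by (auto intro!: continuous_at_imp_continuous_on DERIV_isCont)
  then have "continuous_on UNIV (\<lambda>z. bseries (z\<^sup>2 / 4))"
    by (rule continuous_on_compose2) (auto intro!: continuous_intros)
  then show ?thesis by (simp add: bessel_def[abs_def])
qed

text \<open>The function \<open>w z = z\<^sup>-\<^sup>l bessel z\<close> solves \<open>w'' = (l (l + 1) / z\<^sup>2 - 1) w\<close>, so its energy
  \<open>w\<^sup>2 + w'\<^sup>2\<close> grows at rate at most \<open>1 / z\<^sup>2\<close>, which is integrable at infinity.\<close>

lemma bessel_bound_at_infinity: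
  "\<exists>M. \<forall>z\<ge>1. \<bar>bessel z\<bar> \<le> M * z powr l"
proof -
  define w w' where "w z = z powr (- l) * bseries (z\<^sup>2 / 4)"
    and "w' z = z powr (- l) * (z / 2 * bseries' (z\<^sup>2 / 4) - l / z * bseries (z\<^sup>2 / 4))" for z
  have dq: "((\<lambda>z::real. z\<^sup>2 / 4) has_field_derivative z / 2) (at z)" for z
    by (auto intro!: derivative_eq_intros)
  have dA: "((\<lambda>z. bseries (z\<^sup>2 / 4)) has_field_derivative bseries' (z\<^sup>2 / 4) * (z / 2)) (at z)" for z
    by (rule DERIV_chain2[OF DERIV_bseries dq])
  have dB: "((\<lambda>z. bseries' (z\<^sup>2 / 4)) has_field_derivative bseries'' (z\<^sup>2 / 4) * (z / 2)) (at z)" for z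
    by (rule DERIV_chain2[OF DERIV_bseries' dq])
  have w: "(w has_field_derivative w' z) (at z)" if "z > 0" for z
    unfolding w_def[abs_def] w'_def using that
    by (auto intro!: derivative_eq_intros dA simp: powr_diff algebra_simps)
  have w': "(w' has_field_derivative (l * (l + 1) / z\<^sup>2 - 1) * w z) (at z)" if z: "z > 0" for z
  proof -
    define A B C where "A = bseries (z\<^sup>2 / 4)" and "B = bseries' (z\<^sup>2 / 4)" and "C = bseries'' (z\<^sup>2 / 4)"
    have d0: "((\<lambda>z. z powr (- l)) has_field_derivative (- l / z * z powr (- l))) (at z)"
      using z by (auto intro!: derivative_eq_intros simp: powr_diff)
    have d1: "((\<lambda>z. l / z) has_field_derivative - l / z\<^sup>2) (at z)"
      using z by (auto intro!: derivative_eq_intros simp: power2_eq_square)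
    have d2: "((\<lambda>z. z / 2) has_field_derivative 1 / 2) (at z)"
      by (auto intro!: derivative_eq_intros)
    have "(w' has_field_derivative (- l / z * z powr (- l)) * (z / 2 * B - l / z * A) +
        ((1 / 2 * B + C * (z / 2) * (z / 2)) - (- l / z\<^sup>2 * A + B * (z / 2) * (l / z))) * z powr (- l)) (at z)"
      unfolding w'_def[abs_def] A_def B_def C_def
      by (rule DERIV_mult[OF d0 DERIV_diff[OF DERIV_mult[OF d2 dB] DERIV_mult[OF d1 dA]]])
    moreover have "(- l / z * z powr (- l)) * (z / 2 * B - l / z * A) +
        ((1 / 2 * B + C * (z / 2) * (z / 2)) - (- l / z\<^sup>2 * A + B * (z / 2) * (l / z))) * z powr (- l)
      = z powr (- l) * ((z\<^sup>2 / 4 * C + (1/2 - l) * B) + l * (l + 1) / z\<^sup>2 * A)"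
      using z by (simp add: field_simps power2_eq_square)
    moreover have "z\<^sup>2 / 4 * C + (1/2 - l) * B = - A"
      using bseries_ode[of "z\<^sup>2 / 4"] by (simp add: A_def B_def C_def)
    moreover have "z powr (- l) * (- A + l * (l + 1) / z\<^sup>2 * A) = (l * (l + 1) / z\<^sup>2 - 1) * w z"
      unfolding w_def A_def by (simp add: algebra_simps)
    ultimately show ?thesis by (simp only:)
  qed
  define e where "e z = (w z)\<^sup>2 + (w' z)\<^sup>2" for z
  have e: "(e has_field_derivative 2 * (l * (l + 1) / z\<^sup>2) * (w z * w' z)) (at z)" if "z > 0" for z
    unfolding e_def[abs_def] using that
    by (auto intro!: derivative_eq_intros w w' simp: algebra_simps)
  \<comment> \<open>An integrating factor: |l (l + 1)| \<le> 3/4 yields e' \<le> e / z^2, and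
    exp(1/z) has logarithmic derivative -1/z^2, so \<open>h\<close> cannot increase.\<close>
  define h where "h z = e z * exp (1 / z)" for z
  have h: "h z \<le> h 1" if "z \<ge> 1" for z
  proof (rule DERIV_nonpos_imp_nonincreasing[OF that])
    fix x :: real assume x: "1 \<le> x" "x \<le> z"
    have "(h has_field_derivative (2 * (l * (l + 1) / x\<^sup>2) * (w x * w' x)) * exp (1 / x) + exp (1 / x) * (- 1 / x\<^sup>2) * e x) (at x)"
      unfolding h_def[abs_def] using x
      by (intro DERIV_mult e) (auto intro!: derivative_eq_intros simp: power2_eq_square)
    moreover have "2 * (l * (l + 1) / x\<^sup>2) * (w x * w' x) \<le> e x / x\<^sup>2"
    proof -
      have "\<bar>l * (l + 1)\<bar> \<le> 1/2 * (3/2)" unfolding abs_mult using l by (intro mult_mono) auto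
      then have l1: "\<bar>l * (l + 1)\<bar> \<le> 1" by simp
      have "l * (l + 1) * (2 * (w x * w' x)) \<le> \<bar>l * (l + 1) * (2 * (w x * w' x))\<bar>"
        by (rule abs_ge_self)
      also have "\<dots> \<le> 1 * \<bar>2 * (w x * w' x)\<bar>"
        by (subst abs_mult) (intro mult_right_mono l1 abs_ge_zero)
      also have "\<dots> \<le> e x"
        unfolding e_def using sum_squares_bound[of "\<bar>w x\<bar>" "\<bar>w' x\<bar>"] by (simp add: abs_mult)
      finally show ?thesis by (simp add: divide_right_mono)
    qed
    then have "2 * (l * (l + 1) / x\<^sup>2) * (w x * w' x) * exp (1 / x) \<le> e x / x\<^sup>2 * exp (1 / x)"
      by (intro mult_right_mono) auto
    then have "2 * (l * (l + 1) / x\<^sup>2) * (w x * w' x) * exp (1 / x) + exp (1 / x) * (- 1 / x\<^sup>2) * e x \<le> 0"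
      by (simp add: mult_ac)
    ultimately show "\<exists>y. (h has_real_derivative y) (at x) \<and> y \<le> 0"
      by blast
  qed
  have "\<bar>bessel z\<bar> \<le> sqrt (h 1) * z powr l" if z: "z \<ge> 1" for z
  proof -
    have "(w z)\<^sup>2 \<le> e z" by (simp add: e_def)
    also have "\<dots> \<le> h z"
      unfolding h_def using z mult_left_mono[of 1 "exp (1 / z)" "e z"] by (simp add: e_def)
    also have "\<dots> \<le> h 1" by (rule h[OF z])
    finally have "\<bar>w z\<bar> \<le> sqrt (h 1)" by (metis real_sqrt_abs real_sqrt_le_mono)
    then have "\<bar>w z\<bar> * z powr l \<le> sqrt (h 1) * z powr l" by (intro mult_right_mono) auto
    moreover have "bessel z = w z * z powr l"
      using z powr_add[of z "- l" l] by (simp add: w_def bessel_def mult_ac)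
    ultimately show ?thesis by (simp add: abs_mult)
  qed
  then show ?thesis by blast
qed

text \<open>One constant for both regimes. For l \<le> 0 the second bound extends to 0 < z \<le> 1,
  where z^l \<ge> 1. For l > 0 it cannot, since \<open>bessel 0\<close> = 1 / Gamma(1/2 - l) while
  z^l tends to 0; this is the source of the two different rates.\<close>

lemma bessel_bound:
  obtains M where "M > 0" "\<And>z. 0 \<le> z \<Longrightarrow> z \<le> 1 \<Longrightarrow> \<bar>bessel z\<bar> \<le> M" "\<And>z. 1 \<le> z \<Longrightarrow> \<bar>bessel z\<bar> \<le> M * z powr l"
proof -
  obtain M1 where M1: "\<And>z. z \<ge> 1 \<Longrightarrow> \<bar>bessel z\<bar> \<le> M1 * z powr l" using bessel_bound_at_infinity by blast
  have "compact (bessel ` {0..1})"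
    by (intro compact_continuous_image continuous_on_subset[OF continuous_bessel]) auto
  then have "bounded (bessel ` {0..1})" by (rule compact_imp_bounded)
  then obtain M2 where "\<forall>x\<in>bessel ` {0..1}. norm x \<le> M2"
    unfolding bounded_iff by blast
  then have M2: "\<bar>bessel z\<bar> \<le> M2" if "z \<in> {0..1}" for z
    using that by simp
  have "\<bar>bessel z\<bar> \<le> max 1 (max M1 M2) * z powr l" if "z \<ge> 1" for z
    by (rule order_trans[OF M1[OF that]]) (intro mult_right_mono, auto)
  moreover have "\<bar>bessel z\<bar> \<le> max 1 (max M1 M2)" if "0 \<le> z" "z \<le> 1" for z
    using M2[of z] that by auto
  ultimately show ?thesis using that[of "max 1 (max M1 M2)"] by auto
qed

text \<open>Weber's exponential integral. Integrated term by term, the k-th Gaussian moment cancels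
  the Gamma factor of \<open>bcoeff k\<close> and leaves the exponential series at -\<xi>^2 / (4
  b).\<close>

lemma bessel_gaussian_integral:
  assumes b: "b > 0"
  shows "has_bochner_integral half_line (\<lambda>y. y powr (- 2 * l) * bessel (\<xi> * y) * exp (- b * y\<^sup>2))
     (b powr (- (1/2 - l)) * exp (- \<xi>\<^sup>2 / (4 * b)) / 2)"
proof -
  define p where "p = 1/2 - l"
  have p: "0 < p" using l by (auto simp: p_def)
  define a where "a k = bcoeff k * (\<xi>\<^sup>2 / 4) ^ k" for k
  define m where "m k y = y powr (2 * (real k + p) - 1) * exp (- b * y\<^sup>2)" for k y
  have m: "has_bochner_integral half_line (m k) (Gamma (real k + p) / (2 * b powr (real k + p)))" for k
    unfolding m_def using p b by (intro has_integral_gaussian_moment) auto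
  have m_eq: "m k y = y powr (- 2 * l) * (y\<^sup>2) ^ k * exp (- b * y\<^sup>2)" if "y > 0" for k y
  proof -
    have "2 * (real k + p) - 1 = - 2 * l + real (2 * k)" by (simp add: p_def)
    then have "y powr (2 * (real k + p) - 1) = y powr (- 2 * l) * y ^ (2 * k)"
      using that by (simp only: powr_add powr_realpow)
    then show ?thesis by (simp add: m_def power_mult)
  qed
  have f_eq: "a k * m k y = bcoeff k * ((\<xi> * y)\<^sup>2 / 4) ^ k * (y powr (- 2 * l) * exp (- b * y\<^sup>2))" if "y > 0" for k y
    unfolding m_eq[OF that] a_def by (simp add: power_mult_distrib power_divide)
  have int_eq: "a k * (Gamma (real k + p) / (2 * b powr (real k + p))) =
      1 / (2 * b powr p) * ((- (\<xi>\<^sup>2 / (4 * b))) ^ k /\<^sub>R fact k)" for k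
  proof -
    have "Gamma (real k + p) > 0" using p by (intro Gamma_real_pos) auto
    moreover have "b powr (real k + p) = b ^ k * b powr p" using b by (simp add: powr_add powr_realpow)
    moreover have "(- (\<xi>\<^sup>2 / (4 * b))) ^ k = (- 1) ^ k * (\<xi>\<^sup>2 / 4) ^ k / b ^ k"
      by (subst power_minus) (simp add: power_divide power_mult_distrib)
    ultimately show ?thesis
      using b unfolding a_def bcoeff_def p_def[symmetric] by (simp add: field_simps)
  qed
  have abs_eq: "norm (a k * m k y) = \<bar>a k\<bar> * m k y" for k y
    by (simp add: abs_mult m_def)
  have 1: "integrable half_line (\<lambda>y. a k * m k y)" for k
    using m[of k] by (simp add: has_bochner_integral_iff)
  have 2: "AE y in half_line. summable (\<lambda>k. norm (a k * m k y))"
  proof (rule AE_half_lineI)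
    fix y :: real assume y: "y > 0"
    show "summable (\<lambda>k. norm (a k * m k y))"
      unfolding f_eq[OF y] norm_mult[of "bcoeff _ * _"]
      by (intro summable_mult2 bseries_summable_norm)
  qed
  \<comment> \<open>The L1 norms of the terms form the exponential series at +\<xi>^2 / (4 b); its
    convergence justifies exchanging sum and integral.\<close>
  have "norm (\<integral>y. norm (a k * m k y) \<partial>half_line) \<le> 1 / (2 * b powr p) * ((\<xi>\<^sup>2 / (4 * b)) ^ k /\<^sub>R fact k)" for k
  proof -
    have "(\<integral>y. norm (a k * m k y) \<partial>half_line) = \<bar>a k\<bar> * (Gamma (real k + p) / (2 * b powr (real k + p)))"
      unfolding abs_eq using m[of k] by (simp add: has_bochner_integral_iff)
    also have "\<dots> = \<bar>a k * (Gamma (real k + p) / (2 * b powr (real k + p)))\<bar>"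
      using p by (simp add: abs_mult Gamma_real_nonneg)
    also have "\<dots> = 1 / (2 * b powr p) * ((\<xi>\<^sup>2 / (4 * b)) ^ k /\<^sub>R fact k)"
      unfolding int_eq using b by (simp add: abs_mult power_abs)
    finally show ?thesis using b by (simp add: abs_mult power_abs)
  qed
  then have 3: "summable (\<lambda>k. \<integral>y. norm (a k * m k y) \<partial>half_line)"
    by (intro summable_comparison_test'[OF summable_mult[OF summable_exp_generic]])
  have sum: "(\<Sum>k. a k * m k y) = y powr (- 2 * l) * bessel (\<xi> * y) * exp (- b * y\<^sup>2)" if "y > 0" for y
    unfolding f_eq[OF that] bessel_def bseries_def by (subst suminf_mult2[symmetric, OF bseries_summable]) (simp add: mult_ac)
  have "has_bochner_integral half_line (\<lambda>y. \<Sum>k. a k * m k y) (\<Sum>k. \<integral>y. a k * m k y \<partial>half_line)"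
    unfolding has_bochner_integral_iff using integrable_suminf[OF 1 2 3] integral_suminf[OF 1 2 3] by simp
  moreover have "(\<Sum>k. \<integral>y. a k * m k y \<partial>half_line) = (\<Sum>k. 1 / (2 * b powr p) * ((- (\<xi>\<^sup>2 / (4 * b))) ^ k /\<^sub>R fact k))"
    using m by (intro suminf_cong) (simp only: int_eq[symmetric], simp add: has_bochner_integral_iff)
  moreover have "\<dots> = 1 / (2 * b powr p) * exp (- (\<xi>\<^sup>2 / (4 * b)))"
    unfolding exp_def by (intro suminf_mult summable_exp_generic)
  ultimately have "has_bochner_integral half_line (\<lambda>y. \<Sum>k. a k * m k y) (b powr (- p) * exp (- \<xi>\<^sup>2 / (4 * b)) / 2)"
    by (simp add: powr_minus field_simps)
  then show ?thesis
    unfolding p_def by (subst has_bochner_integral_cong[OF refl _ refl, of half_line _ "\<lambda>y. \<Sum>k. a k * m k y"]) (simp_all add: sum)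
qed

end

section \<open>Density of Gaussians\<close>

lemma L2norm_dominated_convergence:
  assumes [measurable]: "f \<in> borel_measurable half_line" "\<And>n. s n \<in> borel_measurable half_line"
    and h: "(\<lambda>x. complex_of_real (h x)) \<in> L2"
    and lim: "AE x in half_line. (\<lambda>n. s n x) \<longlonglongrightarrow> f x"
    and le: "\<And>n x. x > 0 \<Longrightarrow> cmod (f x - s n x) \<le> h x"
  shows "(\<lambda>n. L2norm (\<lambda>x. f x - s n x)) \<longlonglongrightarrow> 0"
proof -
  have "(\<lambda>n. \<integral>x. (cmod (f x - s n x))\<^sup>2 \<partial>half_line) \<longlonglongrightarrow> (\<integral>x. 0 \<partial>half_line)"
  proof (rule integral_dominated_convergence)
    show "integrable half_line (\<lambda>x. (cmod (complex_of_real (h x)))\<^sup>2)" using L2D(2)[OF h] .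
    show "AE x in half_line. (\<lambda>n. (cmod (f x - s n x))\<^sup>2) \<longlonglongrightarrow> 0"
      using lim by eventually_elim (auto intro!: tendsto_eq_intros)
    show "AE x in half_line. norm ((cmod (f x - s n x))\<^sup>2) \<le> (cmod (complex_of_real (h x)))\<^sup>2" for n
      by (intro AE_half_lineI) (auto intro!: power_mono order_trans[OF le])
  qed auto
  then have "(\<lambda>n. sqrt (\<integral>x. (cmod (f x - s n x))\<^sup>2 \<partial>half_line)) \<longlonglongrightarrow> sqrt 0"
    by (intro tendsto_real_sqrt) simp
  then show ?thesis by (simp add: L2norm_def)
qed

lemma weighted_L1_dominated_convergence:
  assumes [measurable]: "f \<in> borel_measurable half_line" "\<And>n. s n \<in> borel_measurable half_line"
      "v \<in> borel_measurable half_line"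
    and v: "\<And>x. x > 0 \<Longrightarrow> v x \<ge> 0"
    and h: "integrable half_line (\<lambda>x. h x * v x)"
    and lim: "AE x in half_line. (\<lambda>n. s n x) \<longlonglongrightarrow> f x"
    and le: "\<And>n x. x > 0 \<Longrightarrow> cmod (f x - s n x) \<le> h x"
  shows "(\<lambda>n. \<integral>x. cmod (f x - s n x) * v x \<partial>half_line) \<longlonglongrightarrow> 0"
proof -
  have "(\<lambda>n. \<integral>x. cmod (f x - s n x) * v x \<partial>half_line) \<longlonglongrightarrow> (\<integral>x. 0 \<partial>half_line)"
  proof (rule integral_dominated_convergence[OF _ _ h])
    show "AE x in half_line. (\<lambda>n. cmod (f x - s n x) * v x) \<longlonglongrightarrow> 0"
      using lim by eventually_elim (auto intro!: tendsto_eq_intros)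
    show "AE x in half_line. norm (cmod (f x - s n x) * v x) \<le> h x * v x" for n
      by (intro AE_half_lineI) (auto simp: abs_mult v intro!: mult_right_mono le)
  qed auto
  then show ?thesis by simp
qed

section \<open>Almost everywhere approximation by continuous functions and polynomials\<close>

lemma Weierstrass_complex:
  fixes g :: "real \<Rightarrow> complex"
  assumes g: "continuous_on {0..1} g" and e: "e > 0"
  shows "\<exists>c n. \<forall>x\<in>{0..1}. cmod (g x - (\<Sum>i\<le>(n::nat). c i * complex_of_real (x ^ i))) < e"
proof -
  obtain p where p: "real_polynomial_function p" "\<And>x. x \<in> {0..1} \<Longrightarrow> \<bar>Re (g x) - p x\<bar> < e / 2"
    using Stone_Weierstrass_real_polynomial_function[of "{0..1}" "\<lambda>x. Re (g x)" "e / 2"] g e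
    by (auto intro: continuous_intros)
  obtain q where q: "real_polynomial_function q" "\<And>x. x \<in> {0..1} \<Longrightarrow> \<bar>Im (g x) - q x\<bar> < e / 2"
    using Stone_Weierstrass_real_polynomial_function[of "{0..1}" "\<lambda>x. Im (g x)" "e / 2"] g e
    by (auto intro: continuous_intros)
  obtain a m where a: "p = (\<lambda>x. \<Sum>i\<le>m. a i * x ^ i)" using p(1) real_polynomial_function_iff_sum by blast
  obtain b k where b: "q = (\<lambda>x. \<Sum>i\<le>k. b i * x ^ i)" using q(1) real_polynomial_function_iff_sum by blast
  define c where "c i = Complex (if i \<le> m then a i else 0) (if i \<le> k then b i else 0)" for i
  have "Re (\<Sum>i\<le>max m k. c i * complex_of_real (x ^ i)) = p x" for x
    unfolding a by (simp add: c_def if_distrib[of "\<lambda>y. y * _"] cong: if_cong)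
      (intro sum.mono_neutral_cong_right; auto)
  moreover have "Im (\<Sum>i\<le>max m k. c i * complex_of_real (x ^ i)) = q x" for x
    unfolding b by (simp add: c_def if_distrib[of "\<lambda>y. y * _"] cong: if_cong)
      (intro sum.mono_neutral_cong_right; auto)
  ultimately have "cmod (g x - (\<Sum>i\<le>max m k. c i * complex_of_real (x ^ i))) < e" if "x \<in> {0..1}" for x
    using cmod_le[of "g x - (\<Sum>i\<le>max m k. c i * complex_of_real (x ^ i))"] p(2)[OF that] q(2)[OF that]
    by simp
  then show ?thesis by blast
qed

lemma continuous_ae_approx:
  fixes f :: "real \<Rightarrow> complex"
  assumes f: "f \<in> borel_measurable borel" and K: "\<And>x. cmod (f x) \<le> K" "K > 0"
  obtains N g where "negligible N" "\<And>n. continuous_on UNIV (g n)"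
    "\<And>(n::nat) x. cmod (g n x) \<le> K" "\<And>x. x \<notin> N \<Longrightarrow> (\<lambda>n. g n x) \<longlonglongrightarrow> f x"
proof -
  have "f \<in> borel_measurable lborel" using f by simp
  then have "f \<in> borel_measurable lebesgue" by (rule measurable_completion)
  then have "f measurable_on UNIV" by (simp add: measurable_on_iff_borel_measurable)
  then obtain N g where N: "negligible N" and g: "\<And>n. continuous_on UNIV (g n)"
    and lim: "\<And>x. x \<notin> N \<Longrightarrow> (\<lambda>n. g n x) \<longlonglongrightarrow> f x"
    unfolding measurable_on_def by auto
  \<comment> \<open>The radial retraction onto the disc of radius \<open>K\<close>: it is
    continuous, fixes the values of \<open>f\<close>, and bounds the approximants uniformly, as
    dominated convergence will require.\<close>
  define P where "P y = complex_of_real (K / max K (cmod y)) * y" for y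
  have P: "continuous_on UNIV P"
    unfolding P_def using K(2) by (intro continuous_intros) (auto simp: max_def)
  have Ple: "cmod (P y) \<le> K" for y
  proof -
    have pos: "max K (cmod y) > 0" using K(2) by simp
    have "cmod (P y) = K * cmod y / max K (cmod y)"
      unfolding P_def norm_mult norm_of_real using K(2) pos by (simp add: abs_divide)
    also have "\<dots> \<le> K * max K (cmod y) / max K (cmod y)"
      using K(2) pos by (intro divide_right_mono mult_left_mono) auto
    finally show ?thesis using pos by simp
  qed
  have Pf: "P (f x) = f x" for x using K(1)[of x] K(2) by (simp add: P_def max_def)
  show ?thesis
  proof (rule that[of N "\<lambda>n x. P (g n x)"])
    show "continuous_on UNIV (\<lambda>x. P (g n x))" for n
      by (rule continuous_on_compose2[OF P g]) auto
    show "(\<lambda>n. P (g n x)) \<longlonglongrightarrow> f x" if "x \<notin> N" for x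
      using isCont_tendsto_compose[OF continuous_on_interior[OF P] lim[OF that]] Pf by simp
  qed (use N Ple in auto)
qed

lemma AE_half_line_negligible:
  fixes N :: "real set"
  assumes "negligible N"
  shows "AE x in half_line. x \<notin> N"
proof -
  have "N \<in> null_sets lebesgue" using assms by (simp add: negligible_iff_null_sets)
  then have "AE x in lebesgue. x \<notin> N" by (rule AE_not_in)
  then have "AE x in lborel. x \<notin> N" by (simp add: AE_completion_iff)
  then show ?thesis unfolding half_line_def by (subst AE_restrict_space_iff) auto
qed

text \<open>Exceptional sets found in the variable s must stay null in x. The inverse map s
  \<mapsto> sqrt(-ln s) is differentiable on (0,1), hence carries null sets to null sets.\<close>

lemma negligible_gaussian_preimage:
  fixes N :: "real set"
  assumes "negligible N"
  shows "negligible {x. x > 0 \<and> exp (- x\<^sup>2) \<in> N}"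
proof -
  have "negligible ((\<lambda>s. sqrt (- ln s)) ` (N \<inter> {0<..<1}))"
  proof (rule negligible_differentiable_image_negligible)
    show "negligible (N \<inter> {0<..<1})" using assms by (rule negligible_subset) auto
    have "(\<lambda>s. sqrt (- ln s)) differentiable (at s within N \<inter> {0<..<1})" if "0 < s" "s < 1" for s :: real
    proof -
      have "((\<lambda>s. sqrt (- ln s)) has_field_derivative (inverse (sqrt (- ln s)) / 2 * (- (1 / s)))) (at s within N \<inter> {0<..<1})"
        using that by (auto intro!: derivative_eq_intros simp: ln_less_zero_iff)
      then show ?thesis unfolding has_field_derivative_def differentiable_def by blast
    qed
    then show "(\<lambda>s. sqrt (- ln s)) differentiable_on (N \<inter> {0<..<1})"
      unfolding differentiable_on_def by auto
  qed simp
  moreover have "{x. x > 0 \<and> exp (- x\<^sup>2) \<in> N} \<subseteq> (\<lambda>s. sqrt (- ln s)) ` (N \<inter> {0<..<1})"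
  proof
    fix x :: real assume "x \<in> {x. x > 0 \<and> exp (- x\<^sup>2) \<in> N}"
    then show "x \<in> (\<lambda>s. sqrt (- ln s)) ` (N \<inter> {0<..<1})"
      by (intro image_eqI[of _ _ "exp (- x\<^sup>2)"]) auto
  qed
  ultimately show ?thesis by (rule negligible_subset)
qed

text \<open>In the variable \<open>s = exp (- x\<^sup>2)\<close>, density of the Gaussians becomes density of the polynomials.\<close>

lemma gaussian_polynomial_ae_approx:
  fixes \<phi> :: "real \<Rightarrow> complex"
  assumes \<phi>: "\<phi> \<in> borel_measurable half_line" and K: "\<And>x. x > 0 \<Longrightarrow> cmod (\<phi> x) \<le> K" "K > 0"
  shows "\<exists>(c :: nat \<Rightarrow> nat \<Rightarrow> complex) m.
    (\<forall>n x. cmod (\<Sum>i\<le>m n. c n i * complex_of_real (exp (- x\<^sup>2) ^ i)) \<le> K + 1) \<and>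
    (AE x in half_line. (\<lambda>n. \<Sum>i\<le>m n. c n i * complex_of_real (exp (- x\<^sup>2) ^ i)) \<longlonglongrightarrow> \<phi> x)"
proof -
  define \<phi>' where "\<phi>' x = indicat_real {0<..} x *\<^sub>R \<phi> x" for x
  have "\<phi>' \<in> borel_measurable borel"
    using \<phi> unfolding \<phi>'_def half_line_def by (subst (asm) borel_measurable_restrict_space_iff) auto
  then have m: "(\<lambda>s. \<phi>' (sqrt (- ln s))) \<in> borel_measurable borel"
    by (rule measurable_compose[rotated]) measurable
  have "cmod (\<phi>' x) \<le> K" for x using K by (auto simp: \<phi>'_def indicator_def)
  from continuous_ae_approx[OF m this K(2)] obtain N g where N: "negligible N"
    and g: "\<And>n. continuous_on UNIV (g n)" "\<And>(n::nat) x. cmod (g n x) \<le> K"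
      "\<And>s. s \<notin> N \<Longrightarrow> (\<lambda>n. g n s) \<longlonglongrightarrow> \<phi>' (sqrt (- ln s))"
    by blast
  \<comment> \<open>The error 1 / (n + 1) tends to 0 and never exceeds 1, which is the origin of the
    uniform bound K + 1.\<close>
  have "\<exists>c m. \<forall>x\<in>{0..1}. cmod (g n x - (\<Sum>i\<le>(m::nat). c i * complex_of_real (x ^ i))) < 1 / Suc n" for n
  proof -
    have "1 / real (Suc n) > 0" by simp
    then show ?thesis
      by (intro Weierstrass_complex continuous_on_subset[OF g(1)]) auto
  qed
  then obtain c m where c: "\<And>n x. x \<in> {0..1} \<Longrightarrow>
      cmod (g n x - (\<Sum>i\<le>(m n::nat). c n i * complex_of_real (x ^ i))) < 1 / Suc n"
    by metis
  show ?thesis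
  proof (intro exI[of _ c] exI[of _ m] conjI allI)
    fix n :: nat and x :: real
    define s where "s = exp (- x\<^sup>2)"
    have s: "s \<in> {0..1}" by (simp add: s_def)
    have "cmod (\<Sum>i\<le>m n. c n i * complex_of_real (s ^ i)) \<le> cmod (g n s) + cmod (g n s - (\<Sum>i\<le>m n. c n i * complex_of_real (s ^ i)))"
      by (rule norm_triangle_sub[of _ "g n s", unfolded norm_minus_commute[of _ "g n s"]])
    also have "\<dots> \<le> K + 1 / Suc n" by (intro add_mono g(2) less_imp_le[OF c[OF s]])
    also have "\<dots> \<le> K + 1" by (simp add: divide_le_eq)
    finally show "cmod (\<Sum>i\<le>m n. c n i * complex_of_real (exp (- x\<^sup>2) ^ i)) \<le> K + 1"
      by (simp add: s_def)
  next
    have "AE x in half_line. x \<notin> {x. x > 0 \<and> exp (- x\<^sup>2) \<in> N}"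
      by (intro AE_half_line_negligible negligible_gaussian_preimage N)
    moreover have "AE x in half_line. x > 0" by (rule AE_half_lineI)
    ultimately show "AE x in half_line. (\<lambda>n. \<Sum>i\<le>m n. c n i * complex_of_real (exp (- x\<^sup>2) ^ i)) \<longlonglongrightarrow> \<phi> x"
    proof eventually_elim
      fix x :: real assume x: "x \<notin> {x. x > 0 \<and> exp (- x\<^sup>2) \<in> N}" "x > 0"
      define s where "s = exp (- x\<^sup>2)"
      have s: "s \<in> {0..1}" "s \<notin> N" using x by (auto simp: s_def)
      have "(\<lambda>n. g n s) \<longlonglongrightarrow> \<phi> x"
        using g(3)[OF s(2)] x by (simp add: s_def \<phi>'_def)
      moreover have "(\<lambda>n. (\<Sum>i\<le>m n. c n i * complex_of_real (s ^ i)) - g n s) \<longlonglongrightarrow> 0"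
      proof (rule Lim_null_comparison)
        show "\<forall>\<^sub>F n in sequentially. cmod ((\<Sum>i\<le>m n. c n i * complex_of_real (s ^ i)) - g n s) \<le> 1 / Suc n"
          using c[OF s(1)] by (intro always_eventually allI) (simp add: norm_minus_commute less_imp_le)
        show "(\<lambda>n. 1 / real (Suc n)) \<longlonglongrightarrow> 0" using LIMSEQ_inverse_real_of_nat by (simp add: inverse_eq_divide)
      qed
      ultimately have "(\<lambda>n. ((\<Sum>i\<le>m n. c n i * complex_of_real (s ^ i)) - g n s) + g n s) \<longlonglongrightarrow> 0 + \<phi> x"
        by (rule tendsto_add[rotated])
      then show "(\<lambda>n. \<Sum>i\<le>m n. c n i * complex_of_real (exp (- x\<^sup>2) ^ i)) \<longlonglongrightarrow> \<phi> x"
        by (simp add: s_def)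
    qed
  qed
qed


text \<open>Truncating \<open>f\<close> where it exceeds a multiple of \<omega> = x^(-l) exp(-x^2)
  makes the quotient by \<omega> bounded, hence an a.e. limit of uniformly bounded polynomials in
  exp(-x^2). Multiplied back by \<omega>, they converge in both norms under the same majorant, a
  multiple of \<omega>. The factor \<omega> is why the exponents start at
  \<open>Suc 0\<close>.\<close>

lemma gaussian_dense:
  assumes l: "l \<in> {-1/2<..<1/2}" and f: "f \<in> L2"
    and v: "v \<in> borel_measurable half_line" "\<And>x. x > 0 \<Longrightarrow> v x \<ge> 0"
    and fv: "integrable half_line (\<lambda>x. cmod (f x) * v x)"
    and gv: "integrable half_line (\<lambda>x. x powr (- l) * exp (- x\<^sup>2) * v x)"
    and \<epsilon>: "\<epsilon> > 0"
  shows "\<exists>(c :: nat \<Rightarrow> complex) m.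
    L2norm (\<lambda>x. f x - (\<Sum>i\<le>m. c i * complex_of_real (x powr (- l) * exp (- real (Suc i) * x\<^sup>2)))) < \<epsilon> \<and>
    (\<integral>x. cmod (f x - (\<Sum>i\<le>m. c i * complex_of_real (x powr (- l) * exp (- real (Suc i) * x\<^sup>2)))) * v x \<partial>half_line) < \<epsilon>"
proof -
  note [measurable] = L2D(1)[OF f] v(1)
  define \<omega> where "\<omega> x = x powr (- l) * exp (- x\<^sup>2)" for x :: real
  have [measurable]: "\<omega> \<in> borel_measurable half_line" unfolding \<omega>_def by measurable
  have \<omega>_pos: "\<omega> x > 0" if "x > 0" for x using that by (simp add: \<omega>_def)
  have \<omega>_L2: "(\<lambda>x. complex_of_real (\<omega> x)) \<in> L2"
    using gaussian_moment_L2[of "- l" 1] l by (simp add: \<omega>_def)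
  have gv': "integrable half_line (\<lambda>x. \<omega> x * v x)" using gv by (simp add: \<omega>_def)
  define s where "s n x = (if cmod (f x) \<le> real n * \<omega> x then f x else 0)" for n x
  have s_meas [measurable]: "s n \<in> borel_measurable half_line" for n unfolding s_def by measurable
  have s_lim: "AE x in half_line. (\<lambda>n. s n x) \<longlonglongrightarrow> f x"
  proof (rule AE_half_lineI)
    fix x :: real assume x: "x > 0"
    obtain N where N: "cmod (f x) / \<omega> x \<le> real N" using real_arch_simple by blast
    have "s n x = f x" if "n \<ge> N" for n
    proof -
      have "cmod (f x) / \<omega> x \<le> real n" using N that by linarith
      then show ?thesis using \<omega>_pos[OF x] by (simp add: s_def divide_le_eq)
    qed
    then have "\<forall>\<^sub>F n in sequentially. s n x = f x"
      unfolding eventually_sequentially by blast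
    then show "(\<lambda>n. s n x) \<longlonglongrightarrow> f x" by (rule tendsto_eventually)
  qed
  have "(\<lambda>n. L2norm (\<lambda>x. f x - s n x)) \<longlonglongrightarrow> 0"
    using L2D(2)[OF f]
    by (intro L2norm_dominated_convergence[OF _ _ _ s_lim, where h = "\<lambda>x. cmod (f x)"])
      (auto simp: L2_def s_def)
  moreover have "(\<lambda>n. \<integral>x. cmod (f x - s n x) * v x \<partial>half_line) \<longlonglongrightarrow> 0"
    by (intro weighted_L1_dominated_convergence[OF _ _ _ v(2) fv s_lim]) (auto simp: s_def)
  ultimately have "\<forall>\<^sub>F n in sequentially. L2norm (\<lambda>x. f x - s n x) < \<epsilon> / 2 \<and>
      (\<integral>x. cmod (f x - s n x) * v x \<partial>half_line) < \<epsilon> / 2"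
    using \<epsilon> by (intro eventually_conj order_tendstoD(2)[where a = "\<epsilon> / 2"]) auto
  then obtain n where n: "L2norm (\<lambda>x. f x - s n x) < \<epsilon> / 2"
      "(\<integral>x. cmod (f x - s n x) * v x \<partial>half_line) < \<epsilon> / 2"
    unfolding eventually_sequentially by blast
  \<comment> \<open>The added 1 keeps \<open>K\<close> positive also at n = 0, as the polynomial
    approximation demands.\<close>
  define K where "K = real n + 1"
  define \<phi> where "\<phi> x = s n x / complex_of_real (\<omega> x)" for x
  have s_le: "cmod (s n x) \<le> K * \<omega> x" if "x > 0" for x
    using \<omega>_pos[OF that] unfolding K_def s_def by (auto simp: distrib_right)
  have \<phi>: "\<phi> \<in> borel_measurable half_line" "\<And>x. x > 0 \<Longrightarrow> cmod (\<phi> x) \<le> K" "K > 0"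
  proof -
    show "\<phi> \<in> borel_measurable half_line" unfolding \<phi>_def by measurable
    show "cmod (\<phi> x) \<le> K" if "x > 0" for x
      using s_le[OF that] \<omega>_pos[OF that] by (simp add: \<phi>_def norm_divide divide_le_eq)
    show "K > 0" by (simp add: K_def)
  qed
  obtain c :: "nat \<Rightarrow> nat \<Rightarrow> complex" and m where
    c: "\<And>n x. cmod (\<Sum>i\<le>m n. c n i * complex_of_real (exp (- x\<^sup>2) ^ i)) \<le> K + 1"
    and lim: "AE x in half_line. (\<lambda>n. \<Sum>i\<le>m n. c n i * complex_of_real (exp (- x\<^sup>2) ^ i)) \<longlonglongrightarrow> \<phi> x"
    using gaussian_polynomial_ae_approx[OF \<phi>] by blast
  define F where "F k x = (\<Sum>i\<le>m k. c k i * complex_of_real (x powr (- l) * exp (- real (Suc i) * x\<^sup>2)))" for k x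
  have [measurable]: "F k \<in> borel_measurable half_line" for k unfolding F_def by measurable
  have F_eq: "F k x = complex_of_real (\<omega> x) * (\<Sum>i\<le>m k. c k i * complex_of_real (exp (- x\<^sup>2) ^ i))" for k x
  proof -
    have "exp (- real (Suc i) * x\<^sup>2) = exp (- x\<^sup>2) * exp (- x\<^sup>2) ^ i" for i
      by (simp add: exp_of_nat_mult[symmetric] exp_add[symmetric] algebra_simps)
    then show ?thesis unfolding F_def \<omega>_def sum_distrib_left
      by (intro sum.cong refl) (simp only: of_real_mult mult_ac)
  qed
  have "AE x in half_line. x > 0" by (rule AE_half_lineI)
  with lim have F_lim: "AE x in half_line. (\<lambda>k. F k x) \<longlonglongrightarrow> s n x"
  proof eventually_elim
    fix x assume x: "x > (0::real)"
      and "(\<lambda>n. \<Sum>i\<le>m n. c n i * complex_of_real (exp (- x\<^sup>2) ^ i)) \<longlonglongrightarrow> \<phi> x"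
    then have "(\<lambda>k. F k x) \<longlonglongrightarrow> complex_of_real (\<omega> x) * \<phi> x"
      unfolding F_eq by (intro tendsto_mult tendsto_const)
    also have "complex_of_real (\<omega> x) * \<phi> x = s n x" using \<omega>_pos[OF x] by (simp add: \<phi>_def)
    finally show "(\<lambda>k. F k x) \<longlonglongrightarrow> s n x" .
  qed
  have le: "cmod (s n x - F k x) \<le> (2 * K + 1) * \<omega> x" if "x > 0" for k x
  proof -
    have "cmod (F k x) \<le> \<omega> x * (K + 1)"
      unfolding F_eq norm_mult norm_of_real abs_of_pos[OF \<omega>_pos[OF that]]
      by (intro mult_left_mono c less_imp_le[OF \<omega>_pos[OF that]])
    then show ?thesis using s_le[OF that] norm_triangle_ineq4[of "s n x" "F k x"] by (simp add: algebra_simps)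
  qed
  have "(\<lambda>k. L2norm (\<lambda>x. s n x - F k x)) \<longlonglongrightarrow> 0"
    using L2_scale[OF \<omega>_L2, of "complex_of_real (2 * K + 1)"]
    by (intro L2norm_dominated_convergence[OF _ _ _ F_lim le]) (simp_all only: of_real_mult, measurable)
  moreover have "(\<lambda>k. \<integral>x. cmod (s n x - F k x) * v x \<partial>half_line) \<longlonglongrightarrow> 0"
    using integrable_mult_right[OF gv', of "2 * K + 1"]
    by (intro weighted_L1_dominated_convergence[OF _ _ _ v(2) _ F_lim le]) (simp_all only: mult.assoc, measurable)
  ultimately have "\<forall>\<^sub>F k in sequentially. L2norm (\<lambda>x. s n x - F k x) < \<epsilon> / 2 \<and>
      (\<integral>x. cmod (s n x - F k x) * v x \<partial>half_line) < \<epsilon> / 2"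
    using \<epsilon> by (intro eventually_conj order_tendstoD(2)[where a = "\<epsilon> / 2"]) auto
  then obtain k where k: "L2norm (\<lambda>x. s n x - F k x) < \<epsilon> / 2"
      "(\<integral>x. cmod (s n x - F k x) * v x \<partial>half_line) < \<epsilon> / 2"
    unfolding eventually_sequentially by blast
  have d1: "(\<lambda>x. f x - s n x) \<in> L2"
    by (rule L2_dominated(1)[OF _ f]) (auto simp: s_def)
  have d2: "(\<lambda>x. s n x - F k x) \<in> L2"
  proof (rule L2_dominated(1)[OF _ L2_scale[OF \<omega>_L2, of "complex_of_real (2 * K + 1)"]])
    fix x :: real assume x: "x > 0"
    have "cmod (s n x - F k x) \<le> \<bar>(2 * K + 1) * \<omega> x\<bar>" using le[OF x] by (rule order_trans) simp
    then show "cmod (s n x - F k x) \<le> cmod (complex_of_real (2 * K + 1) * complex_of_real (\<omega> x))"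
      by (simp only: of_real_mult[symmetric] norm_of_real)
  qed measurable
  have e1: "L2norm (\<lambda>x. (f x - s n x) + (s n x - F k x)) < \<epsilon>"
    using L2norm_add_le[OF d1 d2] n(1) k(1) by linarith
  have i1: "integrable half_line (\<lambda>x. cmod (f x - s n x) * v x)"
    by (rule Bochner_Integration.integrable_bound[OF fv]) (auto simp: s_def)
  have i2: "integrable half_line (\<lambda>x. cmod (s n x - F k x) * v x)"
  proof (rule Bochner_Integration.integrable_bound[OF integrable_mult_right[OF gv', of "2 * K + 1"]])
    show "AE x in half_line. norm (cmod (s n x - F k x) * v x) \<le> norm ((2 * K + 1) * (\<omega> x * v x))"
    proof (rule AE_half_lineI)
      fix x :: real assume x: "x > 0"
      have "cmod (s n x - F k x) * v x \<le> (2 * K + 1) * \<omega> x * v x"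
        by (intro mult_right_mono le v x)
      then show "norm (cmod (s n x - F k x) * v x) \<le> norm ((2 * K + 1) * (\<omega> x * v x))"
        using v(2)[OF x] by (simp add: mult.assoc)
    qed
  qed measurable
  have "(\<integral>x. cmod (f x - F k x) * v x \<partial>half_line) \<le>
      (\<integral>x. cmod (f x - s n x) * v x + cmod (s n x - F k x) * v x \<partial>half_line)"
  proof (rule integral_mono')
    show "integrable half_line (\<lambda>x. cmod (f x - s n x) * v x + cmod (s n x - F k x) * v x)"
      using i1 i2 by simp
    fix x assume "x \<in> space half_line"
    then show "cmod (f x - F k x) * v x \<le> cmod (f x - s n x) * v x + cmod (s n x - F k x) * v x"
      unfolding distrib_right[symmetric]
      using norm_triangle_ineq[of "f x - s n x" "s n x - F k x"] v(2)[of x] by (intro mult_right_mono) auto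
    show "0 \<le> cmod (f x - s n x) * v x + cmod (s n x - F k x) * v x"
      using \<open>x \<in> space half_line\<close> v(2)[of x] by auto
  qed
  also have "\<dots> < \<epsilon>" using i1 i2 n(2) k(2) by simp
  finally have "(\<integral>x. cmod (f x - F k x) * v x \<partial>half_line) < \<epsilon>" .
  with e1 show ?thesis by (intro exI[of _ "c k"] exI[of _ "m k"]) (simp add: F_def)
qed

section \<open>The kernel bound\<close>

text \<open>The quadratic phase of the Schroedinger kernel at time \<open>t\<close>. Being
  unimodular, it can multiply data and solutions without changing any of the norms.\<close>

definition chirp :: "real \<Rightarrow> real \<Rightarrow> complex" where
  "chirp t x = exp (\<i> * complex_of_real (x\<^sup>2 / (4 * t)))"

lemma norm_chirp [simp]: "cmod (chirp t x) = 1"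
  unfolding chirp_def norm_exp_eq_Re by simp

lemma chirp_measurable [measurable]: "chirp t \<in> borel_measurable borel"
  unfolding chirp_def[abs_def] by measurable

lemma chirp_mult_cnj: "chirp t x * cnj (chirp t x) = 1"
  using complex_norm_square[of "chirp t x"] by simp

lemma cnj_chirp: "cnj (chirp t x) = exp (- (\<i> * complex_of_real (x\<^sup>2 / (4 * t))))"
  unfolding chirp_def exp_cnj by simp

lemma cnj_chirp_measurable [measurable]: "(\<lambda>x. cnj (chirp t x)) \<in> borel_measurable borel"
  unfolding cnj_chirp by measurable

text \<open>For the datum \<open>x\<^sup>-\<^sup>l exp (- b x\<^sup>2 - \<i> x\<^sup>2 / (4 t))\<close> the complex time \<open>\<sigma> + \<i> t\<close> is
  \<open>4 b t \<i> \<sigma>\<close>. Up to a unimodular factor the solution at time \<open>t\<close> is therefore a real Gaussian.\<close>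

lemma gauss_focus:
  assumes l: "l \<in> {-1/2<..<1/2}" and t: "t > 0" and b: "b > 0"
  defines "\<sigma> \<equiv> 1 / (4 * complex_of_real b + \<i> / complex_of_real t)"
  shows "Re \<sigma> > 0"
    and "\<sigma> powr complex_of_real (1/2 - l) * gauss l \<sigma> x =
      complex_of_real (x powr (- l) * exp (- b * x\<^sup>2)) * cnj (chirp t x)"
    and "\<sigma> powr complex_of_real (1/2 - l) * gauss l (\<sigma> + \<i> * complex_of_real t) x =
      exp (- \<i> * complex_of_real ((1/2 - l) * pi / 2)) * chirp t x *
      complex_of_real ((4 * t) powr (- (1/2 - l)) * x powr (- l) *
        (b powr (- (1/2 - l)) * exp (- (x / (2 * t))\<^sup>2 / (4 * b))))"
proof -
  define p where "p = 1/2 - l"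
  define \<kappa> where "\<kappa> = 4 * complex_of_real b + \<i> / complex_of_real t"
  have Re\<kappa>: "Re \<kappa> > 0" using b by (simp add: \<kappa>_def)
  then have \<kappa>0: "\<kappa> \<noteq> 0" by auto
  have \<sigma>: "\<sigma> = 1 / \<kappa>" by (simp add: \<sigma>_def \<kappa>_def)
  have \<sigma>0: "\<sigma> \<noteq> 0" using \<kappa>0 by (simp add: \<sigma>)
  show Re\<sigma>: "Re \<sigma> > 0"
    using Re\<kappa> \<kappa>0 unfolding \<sigma> by (simp add: Re_divide sum_power2_gt_zero_iff complex_eq_iff)
  have pp: "\<sigma> powr complex_of_real p * \<sigma> powr (- complex_of_real p) = 1"
    using \<sigma>0 by (simp add: powr_minus)
  have "exp (- (complex_of_real (x\<^sup>2 / 4) / \<sigma>)) = complex_of_real (exp (- b * x\<^sup>2)) * cnj (chirp t x)"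
  proof -
    have "- (complex_of_real (x\<^sup>2 / 4) / \<sigma>) = complex_of_real (- b * x\<^sup>2) + - (\<i> * complex_of_real (x\<^sup>2 / (4 * t)))"
      unfolding \<sigma> \<kappa>_def using t by (simp add: field_simps)
    then show ?thesis unfolding cnj_chirp by (simp only: exp_add exp_of_real)
  qed
  moreover have "\<sigma> powr complex_of_real p * gauss l \<sigma> x = complex_of_real (x powr (- l)) *
      (\<sigma> powr complex_of_real p * \<sigma> powr (- complex_of_real p)) * exp (- (complex_of_real (x\<^sup>2 / 4) / \<sigma>))"
    by (simp only: gauss_def p_def mult_ac)
  ultimately show "\<sigma> powr complex_of_real (1/2 - l) * gauss l \<sigma> x =
      complex_of_real (x powr (- l) * exp (- b * x\<^sup>2)) * cnj (chirp t x)"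
    unfolding pp unfolding p_def by (simp only: of_real_mult mult_1_right mult.assoc)
  define \<zeta> where "\<zeta> = \<sigma> + \<i> * complex_of_real t"
  \<comment> \<open>With \<kappa> = 1/\<sigma> one has \<zeta> \<kappa> = 1 + i t \<kappa>; the
    imaginary part 1/t of \<kappa> is chosen to cancel the 1, leaving 4 b t i.\<close>
  have \<zeta>: "\<zeta> = \<i> * complex_of_real (4 * b * t) * \<sigma>"
  proof -
    have "\<zeta> * \<kappa> = \<i> * complex_of_real (4 * b * t)"
    proof -
      have "\<i> * complex_of_real t * \<kappa> = \<i> * complex_of_real (4 * b * t) - 1"
        unfolding \<kappa>_def using t by (simp add: field_simps)
      moreover have "1 / \<kappa> * \<kappa> = 1" using \<kappa>0 by simp
      ultimately show ?thesis unfolding \<zeta>_def \<sigma> distrib_right by simp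
    qed
    then show ?thesis using \<kappa>0 by (simp add: \<sigma> field_simps)
  qed
  have \<zeta>0: "\<zeta> \<noteq> 0" using Re\<sigma> by (auto simp: \<zeta>_def complex_eq_iff)
  \<comment> \<open>The argument of \<sigma> lies strictly between -pi/2 and pi/2, so adding pi/2
    stays on the principal branch and the complex powers factor without a correction.\<close>
  have Ln: "Ln \<zeta> = Ln \<sigma> + complex_of_real (ln (4 * b * t)) + \<i> * complex_of_real (pi / 2)"
  proof (rule Ln_unique)
    have "exp (complex_of_real (ln (4 * b * t))) = complex_of_real (4 * b * t)"
      using b t by (simp add: exp_of_real)
    moreover have "exp (\<i> * complex_of_real (pi / 2)) = \<i>" by (simp add: exp_eq_polar cis_conv_exp[symmetric])
    ultimately show "exp (Ln \<sigma> + complex_of_real (ln (4 * b * t)) + \<i> * complex_of_real (pi / 2)) = \<zeta>"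
      unfolding exp_add \<zeta> using \<sigma>0 by simp
    have "\<bar>Im (Ln \<sigma>)\<bar> < pi / 2" using Re\<sigma> Re_Ln_pos_lt[OF \<sigma>0] by simp
    then show "- pi < Im (Ln \<sigma> + complex_of_real (ln (4 * b * t)) + \<i> * complex_of_real (pi / 2))"
      "Im (Ln \<sigma> + complex_of_real (ln (4 * b * t)) + \<i> * complex_of_real (pi / 2)) \<le> pi"
      by (simp_all add: abs_less_iff)
  qed
  have 1: "\<sigma> powr complex_of_real p * \<zeta> powr (- complex_of_real p) =
      exp (- \<i> * complex_of_real (p * pi / 2)) * complex_of_real ((4 * t) powr (- p) * b powr (- p))"
  proof -
    have "\<sigma> powr complex_of_real p * \<zeta> powr (- complex_of_real p) =
        exp (complex_of_real p * Ln \<sigma> + (- complex_of_real p) * Ln \<zeta>)"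
      unfolding exp_add using \<sigma>0 \<zeta>0 by (simp add: powr_def)
    also have "complex_of_real p * Ln \<sigma> + (- complex_of_real p) * Ln \<zeta> =
       - \<i> * complex_of_real (p * pi / 2) + complex_of_real (- p * ln (4 * b * t))"
      unfolding Ln by (simp add: algebra_simps)
    also have "exp \<dots> = exp (- \<i> * complex_of_real (p * pi / 2)) * complex_of_real (exp (- p * ln (4 * b * t)))"
      unfolding exp_add exp_of_real ..
    also have "exp (- p * ln (4 * b * t)) = (4 * t) powr (- p) * b powr (- p)"
      using b t by (simp add: powr_def ln_mult exp_add[symmetric] algebra_simps)
    finally show ?thesis .
  qed
  have 2: "exp (- (complex_of_real (x\<^sup>2 / 4) / \<zeta>)) = chirp t x * complex_of_real (exp (- (x / (2 * t))\<^sup>2 / (4 * b)))"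
  proof -
    have "1 / \<zeta> = \<kappa> / (\<i> * complex_of_real (4 * b * t))" unfolding \<zeta> \<sigma> by simp
    also have "\<dots> = - \<i> / complex_of_real t + 1 / (4 * complex_of_real b * complex_of_real t ^ 2)"
      unfolding \<kappa>_def using b t by (simp add: field_simps power2_eq_square)
    finally have "- (complex_of_real (x\<^sup>2 / 4) / \<zeta>) = - complex_of_real (x\<^sup>2 / 4) *
        (- \<i> / complex_of_real t + 1 / (4 * complex_of_real b * complex_of_real t ^ 2))"
      by (metis mult_minus_left times_divide_eq_right mult.right_neutral)
    also have "\<dots> = \<i> * complex_of_real (x\<^sup>2 / (4 * t)) + complex_of_real (- (x / (2 * t))\<^sup>2 / (4 * b))"
      using b t by (simp add: field_simps power2_eq_square)
    finally show ?thesis unfolding chirp_def by (simp only: exp_add exp_of_real)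
  qed
  have "\<sigma> powr complex_of_real p * gauss l \<zeta> x = complex_of_real (x powr (- l)) *
      (\<sigma> powr complex_of_real p * \<zeta> powr (- complex_of_real p)) * exp (- (complex_of_real (x\<^sup>2 / 4) / \<zeta>))"
    by (simp only: gauss_def p_def mult_ac)
  then show "\<sigma> powr complex_of_real (1/2 - l) * gauss l (\<sigma> + \<i> * complex_of_real t) x =
      exp (- \<i> * complex_of_real ((1/2 - l) * pi / 2)) * chirp t x *
      complex_of_real ((4 * t) powr (- (1/2 - l)) * x powr (- l) *
        (b powr (- (1/2 - l)) * exp (- (x / (2 * t))\<^sup>2 / (4 * b))))"
    unfolding 1 2 unfolding p_def \<zeta>_def by (simp only: of_real_mult mult_ac)
qed

lemma chirped_gaussian_evolution:
  assumes l: "l \<in> {-1/2<..<1/2}" and U: "is_exp_group (H_graph l (pi / 2)) U" and t: "t > 0" and b: "b > 0"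
  shows "(\<lambda>x. complex_of_real (x powr (- l) * exp (- b * x\<^sup>2)) * cnj (chirp t x)) \<in> L2"
    and "ae_eq (U t (\<lambda>x. complex_of_real (x powr (- l) * exp (- b * x\<^sup>2)) * cnj (chirp t x)))
      (\<lambda>x. exp (- \<i> * complex_of_real ((1/2 - l) * pi / 2)) * chirp t x *
      complex_of_real ((4 * t) powr (- (1/2 - l)) * x powr (- l) *
        (b powr (- (1/2 - l)) * exp (- (x / (2 * t))\<^sup>2 / (4 * b)))))"
proof -
  define \<sigma> where "\<sigma> = 1 / (4 * complex_of_real b + \<i> / complex_of_real t)"
  define c where "c = \<sigma> powr complex_of_real (1/2 - l)"
  note F = gauss_focus[OF l t b, folded \<sigma>_def]
  note G = gauss_L2(1)[OF l F(1)]
  have UG: "unitary_group U" using U by (simp add: is_exp_group_def)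
  show "(\<lambda>x. complex_of_real (x powr (- l) * exp (- b * x\<^sup>2)) * cnj (chirp t x)) \<in> L2"
    unfolding F(2)[symmetric] by (rule L2_scale[OF G])
  have "ae_eq (U t (\<lambda>x. c * gauss l \<sigma> x + 0 * gauss l \<sigma> x)) (\<lambda>x. c * U t (gauss l \<sigma>) x + 0 * U t (gauss l \<sigma>) x)"
    by (rule unitary_groupD(3)[OF UG G G])
  moreover have "ae_eq (U t (gauss l \<sigma>)) (gauss l (\<sigma> + \<i> * complex_of_real t))"
    by (rule gauss_evolution[OF l U F(1)])
  ultimately have "ae_eq (U t (\<lambda>x. c * gauss l \<sigma> x)) (\<lambda>x. c * gauss l (\<sigma> + \<i> * complex_of_real t) x)"
    unfolding ae_eq_def by eventually_elim simp
  then show "ae_eq (U t (\<lambda>x. complex_of_real (x powr (- l) * exp (- b * x\<^sup>2)) * cnj (chirp t x)))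
      (\<lambda>x. exp (- \<i> * complex_of_real ((1/2 - l) * pi / 2)) * chirp t x *
      complex_of_real ((4 * t) powr (- (1/2 - l)) * x powr (- l) *
        (b powr (- (1/2 - l)) * exp (- (x / (2 * t))\<^sup>2 / (4 * b)))))"
    unfolding c_def F(2,3) .
qed

text \<open>The Bessel kernel does not depend on the Gaussian parameter, so linearity makes
  \<open>U t\<close> an integral operator on the whole span. The hypothesis \<open>kernel\<close> is
  stated with abstract weights so that one argument serves both estimates; the factor 2 offsets the
  1/2 in the Bessel-Gauss integral.\<close>

lemma dispersive_bound_gaussian_span:
  fixes c :: "nat \<Rightarrow> complex" and m :: nat and w v :: "real \<Rightarrow> real"
  assumes l: "l \<in> {-1/2<..<1/2}" and U: "is_exp_group (H_graph l (pi / 2)) U" and t: "t > 0"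
    and kernel: "\<And>x y. x > 0 \<Longrightarrow> y > 0 \<Longrightarrow>
      x powr (- l) * y powr (- l) * \<bar>bessel l (x / (2 * t) * y)\<bar> * w x \<le> B * v y"
    and w: "\<And>x. x > 0 \<Longrightarrow> w x \<ge> 0"
  defines "F \<equiv> \<lambda>x. \<Sum>i\<le>m. c i * (complex_of_real (x powr (- l) * exp (- real (Suc i) * x\<^sup>2)) * cnj (chirp t x))"
  assumes Fv: "integrable half_line (\<lambda>x. cmod (F x) * v x)"
  shows "F \<in> L2"
    and "AE x in half_line. cmod (U t F x) * w x \<le> 2 * (4 * t) powr (- 1/2 + l) * B * (\<integral>y. cmod (F y) * v y \<partial>half_line)"
proof -
  have UG: "unitary_group U" using U by (simp add: is_exp_group_def)
  define e where "e i x = complex_of_real (x powr (- l) * exp (- real (Suc i) * x\<^sup>2)) * cnj (chirp t x)" for i x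
  have F: "F = (\<lambda>x. \<Sum>i\<le>m. c i * e i x)" by (simp add: F_def e_def)
  define h where "h i x = real (Suc i) powr (- (1/2 - l)) * exp (- (x / (2 * t))\<^sup>2 / (4 * real (Suc i)))" for i x
  define \<omega> where "\<omega> = exp (- \<i> * complex_of_real ((1/2 - l) * pi / 2))"
  have e: "e i \<in> L2" "ae_eq (U t (e i)) (\<lambda>x. \<omega> * chirp t x *
      complex_of_real ((4 * t) powr (- (1/2 - l)) * x powr (- l) * h i x))" for i
    using chirped_gaussian_evolution[OF l U t, of "real (Suc i)"]
    unfolding e_def[abs_def] \<omega>_def h_def by auto
  show "F \<in> L2" unfolding F by (intro L2_sum L2_scale e) auto
  have "ae_eq (U t F) (\<lambda>x. \<Sum>i\<le>m. c i * U t (e i) x)"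
    unfolding F by (intro unitary_group_sum[OF UG] e) auto
  moreover have "AE x in half_line. \<forall>i\<in>{..m}. U t (e i) x = \<omega> * chirp t x *
      complex_of_real ((4 * t) powr (- (1/2 - l)) * x powr (- l) * h i x)"
    using e(2) unfolding ae_eq_def by (intro AE_finite_allI) auto
  moreover have "AE x in half_line. x > 0" by (rule AE_half_lineI)
  ultimately show "AE x in half_line. cmod (U t F x) * w x \<le>
      2 * (4 * t) powr (- 1/2 + l) * B * (\<integral>y. cmod (F y) * v y \<partial>half_line)"
    unfolding ae_eq_def
  proof eventually_elim
    fix x assume UF: "U t F x = (\<Sum>i\<le>m. c i * U t (e i) x)"
      and Ue: "\<forall>i\<in>{..m}. U t (e i) x = \<omega> * chirp t x *
        complex_of_real ((4 * t) powr (- (1/2 - l)) * x powr (- l) * h i x)"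
      and x: "x > (0::real)"
    define \<xi> where "\<xi> = x / (2 * t)"
    define k where "k i y = y powr (- 2 * l) * bessel l (\<xi> * y) * exp (- real (Suc i) * y\<^sup>2)" for i y
    have k: "has_bochner_integral half_line (k i) (h i x / 2)" for i
      unfolding k_def h_def \<xi>_def by (rule bessel_gaussian_integral[OF l]) simp
    have kc: "has_bochner_integral half_line (\<lambda>y. \<Sum>i\<le>m. c i * complex_of_real (k i y))
        (\<Sum>i\<le>m. c i * complex_of_real (h i x / 2))"
      by (intro has_bochner_integral_sum has_bochner_integral_mult_right has_bochner_integral_of_real k)
    have "U t F x = \<omega> * chirp t x * complex_of_real ((4 * t) powr (- (1/2 - l)) * x powr (- l)) *
        (2 * (\<Sum>i\<le>m. c i * complex_of_real (h i x / 2)))"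
      unfolding UF sum_distrib_left using Ue by (intro sum.cong) (auto simp: mult_ac)
    also have "cmod \<dots> = (4 * t) powr (- (1/2 - l)) * x powr (- l) * 2 * cmod (\<Sum>i\<le>m. c i * complex_of_real (h i x / 2))"
      using t by (simp add: norm_mult \<omega>_def norm_exp_eq_Re del: of_real_divide)
    finally have 1: "cmod (U t F x) * w x = 2 * (4 * t) powr (- 1/2 + l) *
        (x powr (- l) * w x * cmod (\<Sum>i\<le>m. c i * complex_of_real (h i x / 2)))"
      by (simp add: mult_ac)
    \<comment> \<open>Of y^(-2 l), one half belongs to the datum and the other to the kernel; the
      chirp undoes the conjugate chirp inside \<open>F\<close>.\<close>
    have k_eq: "(\<Sum>i\<le>m. c i * complex_of_real (k i y)) = complex_of_real (y powr (- l) * bessel l (\<xi> * y)) * (F y * chirp t y)"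
      for y
    proof -
      have "complex_of_real (k i y) = complex_of_real (y powr (- l) * bessel l (\<xi> * y)) * (e i y * chirp t y)" for i
      proof -
        have "e i y * chirp t y = complex_of_real (y powr (- l) * exp (- real (Suc i) * y\<^sup>2)) * (chirp t y * cnj (chirp t y))"
          by (simp only: e_def mult_ac)
        moreover have "y powr (- 2 * l) = y powr (- l) * y powr (- l)" by (simp flip: powr_add)
        ultimately show ?thesis unfolding k_def chirp_mult_cnj by (simp only: of_real_mult mult_ac mult_1_right mult_1_left)
      qed
      then show ?thesis unfolding F sum_distrib_left sum_distrib_right by (simp only: mult_ac)
    qed
    have int: "integrable half_line (\<lambda>y. complex_of_real (y powr (- l) * bessel l (\<xi> * y)) * (F y * chirp t y))"
      using kc unfolding k_eq by (simp add: has_bochner_integral_iff)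
    have "cmod (\<Sum>i\<le>m. c i * complex_of_real (h i x / 2)) =
        cmod (\<integral>y. complex_of_real (y powr (- l) * bessel l (\<xi> * y)) * (F y * chirp t y) \<partial>half_line)"
      using kc unfolding k_eq by (simp add: has_bochner_integral_iff)
    also have "\<dots> \<le> (\<integral>y. cmod (complex_of_real (y powr (- l) * bessel l (\<xi> * y)) * (F y * chirp t y)) \<partial>half_line)"
      by (rule integral_norm_bound)
    also have "(\<lambda>y. cmod (complex_of_real (y powr (- l) * bessel l (\<xi> * y)) * (F y * chirp t y))) =
        (\<lambda>y. y powr (- l) * \<bar>bessel l (\<xi> * y)\<bar> * cmod (F y))"
      by (simp add: norm_mult abs_mult)
    finally have "x powr (- l) * w x * cmod (\<Sum>i\<le>m. c i * complex_of_real (h i x / 2)) \<le>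
       x powr (- l) * w x * (\<integral>y. y powr (- l) * \<bar>bessel l (\<xi> * y)\<bar> * cmod (F y) \<partial>half_line)"
      using w[OF x] by (intro mult_left_mono) auto
    also have "\<dots> = (\<integral>y. x powr (- l) * w x * (y powr (- l) * \<bar>bessel l (\<xi> * y)\<bar> * cmod (F y)) \<partial>half_line)"
      by simp
    also have "\<dots> \<le> (\<integral>y. B * (cmod (F y) * v y) \<partial>half_line)"
    proof (rule integral_mono)
      have "integrable half_line (\<lambda>y. y powr (- l) * \<bar>bessel l (\<xi> * y)\<bar> * cmod (F y))"
        using integrable_norm[OF int] by (simp add: norm_mult abs_mult)
      then show "integrable half_line (\<lambda>y. x powr (- l) * w x * (y powr (- l) * \<bar>bessel l (\<xi> * y)\<bar> * cmod (F y)))"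
        by (rule integrable_mult_right)
      show "integrable half_line (\<lambda>y. B * (cmod (F y) * v y))" using Fv by simp
      fix y assume "y \<in> space half_line"
      then have "x powr (- l) * y powr (- l) * \<bar>bessel l (\<xi> * y)\<bar> * w x * cmod (F y) \<le> B * v y * cmod (F y)"
        unfolding \<xi>_def by (intro mult_right_mono kernel x) auto
      then show "x powr (- l) * w x * (y powr (- l) * \<bar>bessel l (\<xi> * y)\<bar> * cmod (F y)) \<le> B * (cmod (F y) * v y)"
        by (simp only: mult_ac)
    qed
    finally have "x powr (- l) * w x * cmod (\<Sum>i\<le>m. c i * complex_of_real (h i x / 2)) \<le>
      B * (\<integral>y. cmod (F y) * v y \<partial>half_line)" by simp
    then show "cmod (U t F x) * w x \<le> 2 * (4 * t) powr (- 1/2 + l) * B * (\<integral>y. cmod (F y) * v y \<partial>half_line)"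
      unfolding 1 mult.assoc by (intro mult_left_mono) auto
  qed
qed

text \<open>\<open>U t\<close> is continuous only in \<open>L2\<close>, whereas the bounds are
  pointwise. L2 convergence gives a.e. convergence along a subsequence, which is enough to pass to
  the limit.\<close>

lemma L2_limit_pointwise_bound:
  assumes G: "G \<in> L2" "\<And>n. Gs n \<in> L2" and lim: "(\<lambda>n. L2norm (\<lambda>x. G x - Gs n x)) \<longlonglongrightarrow> 0"
    and le: "\<And>n. AE x in half_line. cmod (Gs n x) * w x \<le> A n" and A: "A \<longlonglongrightarrow> a"
  shows "AE x in half_line. cmod (G x) * w x \<le> a"
proof -
  define u where "u n x = (cmod (G x - Gs n x))\<^sup>2" for n :: nat and x
  have u: "integrable half_line (u n)" for n
    unfolding u_def using L2D(2)[OF L2_diff[OF G(1) G(2)]] .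
  have "(\<lambda>n. (L2norm (\<lambda>x. G x - Gs n x))\<^sup>2) \<longlonglongrightarrow> 0\<^sup>2" by (intro tendsto_power lim)
  then have "(\<lambda>n. \<integral>x. norm (u n x) \<partial>half_line) \<longlonglongrightarrow> 0"
    by (simp add: L2norm_sq u_def)
  from tendsto_L1_AE_subseq[OF u this] obtain r :: "nat \<Rightarrow> nat" where r: "strict_mono r"
    "AE x in half_line. (\<lambda>n. u (r n) x) \<longlonglongrightarrow> 0" by blast
  have "AE x in half_line. \<forall>n. cmod (Gs n x) * w x \<le> A n" using le by (simp add: AE_all_countable)
  with r(2) show ?thesis
  proof eventually_elim
    fix x assume u0: "(\<lambda>n. u (r n) x) \<longlonglongrightarrow> 0" and le: "\<forall>n. cmod (Gs n x) * w x \<le> A n"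
    have "(\<lambda>n. sqrt (u (r n) x)) \<longlonglongrightarrow> sqrt 0" by (intro tendsto_real_sqrt u0)
    then have "(\<lambda>n. cmod (Gs (r n) x - G x)) \<longlonglongrightarrow> 0" by (simp add: u_def norm_minus_commute)
    then have "(\<lambda>n. Gs (r n) x) \<longlonglongrightarrow> G x" by (simp add: tendsto_norm_zero_iff LIM_zero_iff)
    then have "(\<lambda>n. cmod (Gs (r n) x) * w x) \<longlonglongrightarrow> cmod (G x) * w x" by (intro tendsto_intros)
    moreover have "(\<lambda>n. A (r n)) \<longlonglongrightarrow> a" using LIMSEQ_subseq_LIMSEQ[OF A r(1)] by (simp add: o_def)
    ultimately show "cmod (G x) * w x \<le> a" by (rule LIMSEQ_le) (use le in auto)
  qed
qed

lemma dispersive_bound: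
  assumes l: "l \<in> {-1/2<..<1/2}" and U: "is_exp_group (H_graph l (pi / 2)) U" and t: "t > 0"
    and kernel: "\<And>x y. x > 0 \<Longrightarrow> y > 0 \<Longrightarrow>
      x powr (- l) * y powr (- l) * \<bar>bessel l (x / (2 * t) * y)\<bar> * w x \<le> B * v y"
    and w: "w \<in> borel_measurable half_line" "\<And>x. x > 0 \<Longrightarrow> w x \<ge> 0"
    and v: "v \<in> borel_measurable half_line" "\<And>x. x > 0 \<Longrightarrow> v x \<ge> 0"
    and gv: "integrable half_line (\<lambda>x. x powr (- l) * exp (- x\<^sup>2) * v x)"
    and B: "B \<ge> 0"
  shows "norm_L1_Linf v w (U t) \<le> ennreal (2 * (4 * t) powr (- 1/2 + l) * B)"
  unfolding norm_L1_Linf_def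
proof (rule SUP_least)
  define C where "C = 2 * (4 * t) powr (- 1/2 + l) * B"
  have C: "C \<ge> 0" using B by (simp add: C_def)
  have UG: "unitary_group U" using U by (simp add: is_exp_group_def)
  fix f assume "f \<in> {f \<in> L2. L1norm v f \<le> 1}"
  then have f: "f \<in> L2" and f1: "L1norm v f \<le> 1" by auto
  note [measurable] = L2D(1)[OF f] v(1) w(1)
  have nn: "AE x in half_line. 0 \<le> cmod (f x) * v x" using v(2) by (intro AE_half_lineI) simp
  have "(\<integral>\<^sup>+x. ennreal (norm (cmod (f x) * v x)) \<partial>half_line) = L1norm v f"
    unfolding L1norm_def using v(2) by (intro nn_integral_cong) (simp add: abs_mult)
  with f1 have fv: "integrable half_line (\<lambda>x. cmod (f x) * v x)"
    by (intro integrableI_bounded) (auto simp: less_top[symmetric] top_unique intro: le_less_trans)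
  have fv1: "(\<integral>x. cmod (f x) * v x \<partial>half_line) \<le> 1"
    using nn_integral_eq_integral[OF fv nn] f1 unfolding L1norm_def by simp
  \<comment> \<open>The orbits are known for Gaussians times the conjugate chirp, so density is
    applied to \<open>f\<close> times the chirp. Undoing this unimodular factor leaves the
    approximation errors unchanged in both norms.\<close>
  define f' where "f' x = f x * chirp t x" for x
  have [measurable]: "f' \<in> borel_measurable half_line" unfolding f'_def by measurable
  have f': "f' \<in> L2" "cmod (f' x) = cmod (f x)" for x
    using L2D(2)[OF f] by (auto simp: L2_def f'_def norm_mult)
  have fv': "integrable half_line (\<lambda>x. cmod (f' x) * v x)" using fv by (simp add: f'(2))
  have "\<exists>F. F \<in> L2 \<and> L2norm (\<lambda>x. f x - F x) < 1 / Suc n \<and>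
      (AE x in half_line. cmod (U t F x) * w x \<le> C * (1 + 1 / Suc n))" for n
  proof -
    obtain c :: "nat \<Rightarrow> complex" and m where
      c: "L2norm (\<lambda>x. f' x - (\<Sum>i\<le>m. c i * complex_of_real (x powr (- l) * exp (- real (Suc i) * x\<^sup>2)))) < 1 / Suc n"
        "(\<integral>x. cmod (f' x - (\<Sum>i\<le>m. c i * complex_of_real (x powr (- l) * exp (- real (Suc i) * x\<^sup>2)))) * v x \<partial>half_line) < 1 / Suc n"
      using gaussian_dense[OF l f'(1) v fv' gv, of "1 / Suc n"] by auto
    define P where "P x = (\<Sum>i\<le>m. c i * complex_of_real (x powr (- l) * exp (- real (Suc i) * x\<^sup>2)))" for x
    define F where "F x = (\<Sum>i\<le>m. c i * (complex_of_real (x powr (- l) * exp (- real (Suc i) * x\<^sup>2)) * cnj (chirp t x)))" for x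
    have [measurable]: "P \<in> borel_measurable half_line" unfolding P_def by measurable
    have FP: "F x = P x * cnj (chirp t x)" for x
      unfolding F_def P_def sum_distrib_right by (simp only: mult.assoc)
    have [measurable]: "F \<in> borel_measurable half_line" unfolding F_def by measurable
    have f_eq: "f x = f' x * cnj (chirp t x)" for x
      using chirp_mult_cnj[of t x] by (simp add: f'_def mult.assoc)
    have diff: "cmod (f x - F x) = cmod (f' x - P x)" for x
      unfolding f_eq FP left_diff_distrib[symmetric] by (simp add: norm_mult)
    have nF: "cmod (F x) = cmod (P x)" for x unfolding FP by (simp add: norm_mult)
    have Pv: "integrable half_line (\<lambda>x. cmod (P x) * v x)"
    proof (rule Bochner_Integration.integrable_bound)
      show "integrable half_line (\<lambda>x. (\<Sum>i\<le>m. cmod (c i)) * (x powr (- l) * exp (- x\<^sup>2) * v x))"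
        using gv by (rule integrable_mult_right)
      show "AE x in half_line. norm (cmod (P x) * v x) \<le> norm ((\<Sum>i\<le>m. cmod (c i)) * (x powr (- l) * exp (- x\<^sup>2) * v x))"
      proof (rule AE_half_lineI)
        fix x :: real assume x: "x > 0"
        have "cmod (P x) \<le> (\<Sum>i\<le>m. cmod (c i)) * (x powr (- l) * exp (- x\<^sup>2))"
          unfolding P_def sum_distrib_right
        proof (intro sum_norm_le)
          fix i
          have "exp (- real (Suc i) * x\<^sup>2) \<le> exp (- x\<^sup>2)" by (simp add: algebra_simps)
          then show "cmod (c i * complex_of_real (x powr (- l) * exp (- real (Suc i) * x\<^sup>2))) \<le> cmod (c i) * (x powr (- l) * exp (- x\<^sup>2))"
            unfolding norm_mult norm_of_real abs_mult by (intro mult_mono) auto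
        qed
        then have "cmod (P x) * v x \<le> (\<Sum>i\<le>m. cmod (c i)) * (x powr (- l) * exp (- x\<^sup>2)) * v x"
          using v(2)[OF x] by (rule mult_right_mono)
        then show "norm (cmod (P x) * v x) \<le> norm ((\<Sum>i\<le>m. cmod (c i)) * (x powr (- l) * exp (- x\<^sup>2) * v x))"
          using v(2)[OF x] by (simp add: abs_mult sum_nonneg mult.assoc)
      qed
    qed measurable
    have Fv: "integrable half_line (\<lambda>x. cmod (F x) * v x)" using Pv by (simp only: nF)
    have dv: "integrable half_line (\<lambda>x. cmod (f' x - P x) * v x)"
    proof (rule Bochner_Integration.integrable_bound)
      show "integrable half_line (\<lambda>x. cmod (f' x) * v x + cmod (P x) * v x)" using fv' Pv by simp
      show "AE x in half_line. norm (cmod (f' x - P x) * v x) \<le> norm (cmod (f' x) * v x + cmod (P x) * v x)"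
      proof (rule AE_half_lineI)
        fix x :: real assume x: "x > 0"
        have "cmod (f' x - P x) * v x \<le> (cmod (f' x) + cmod (P x)) * v x"
          using v(2)[OF x] by (intro mult_right_mono norm_triangle_ineq4)
        then show "norm (cmod (f' x - P x) * v x) \<le> norm (cmod (f' x) * v x + cmod (P x) * v x)"
          using v(2)[OF x] by (simp add: distrib_right)
      qed
      show "(\<lambda>x. cmod (f' x - P x) * v x) \<in> borel_measurable half_line"
        by measurable
    qed
    have "(\<integral>y. cmod (F y) * v y \<partial>half_line) \<le> (\<integral>y. cmod (f' y - P y) * v y + cmod (f y) * v y \<partial>half_line)"
    proof (rule integral_mono[OF Fv])
      show "integrable half_line (\<lambda>y. cmod (f' y - P y) * v y + cmod (f y) * v y)" using dv fv by simp
      fix y assume "y \<in> space half_line"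
      then have "v y \<ge> 0" using v(2) by simp
      moreover have "cmod (F y) \<le> cmod (f' y - P y) + cmod (f y)"
        unfolding diff[symmetric] using norm_triangle_ineq4[of "f y" "f y - F y"] by simp
      ultimately show "cmod (F y) * v y \<le> cmod (f' y - P y) * v y + cmod (f y) * v y"
        unfolding distrib_right[symmetric] by (rule mult_right_mono[rotated])
    qed
    also have "\<dots> \<le> 1 + 1 / Suc n" using dv fv fv1 c(2) by (simp add: P_def)
    finally have "C * (\<integral>y. cmod (F y) * v y \<partial>half_line) \<le> C * (1 + 1 / Suc n)"
      using C by (rule mult_left_mono)
    moreover note dispersive_bound_gaussian_span[OF l U t kernel w(2), of c m, folded F_def C_def, OF _ _ _ Fv]
    ultimately have "F \<in> L2" "AE x in half_line. cmod (U t F x) * w x \<le> C * (1 + 1 / Suc n)"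
      by (auto elim!: eventually_mono intro: order_trans)
    moreover have "L2norm (\<lambda>x. f x - F x) < 1 / Suc n"
      using c(1) unfolding L2norm_def diff P_def .
    ultimately show ?thesis by blast
  qed
  then obtain F where F: "\<And>n. F n \<in> L2" "\<And>n. L2norm (\<lambda>x. f x - F n x) < 1 / Suc n"
      "\<And>n. AE x in half_line. cmod (U t (F n) x) * w x \<le> C * (1 + 1 / Suc n)"
    by metis
  have inv: "(\<lambda>n. 1 / real (Suc n)) \<longlonglongrightarrow> 0" using LIMSEQ_inverse_real_of_nat by (simp add: inverse_eq_divide)
  have "AE x in half_line. cmod (U t f x) * w x \<le> C"
  proof (rule L2_limit_pointwise_bound[of _ "\<lambda>n. U t (F n)"])
    show "U t f \<in> L2" "U t (F n) \<in> L2" for n by (intro unitary_groupD(1)[OF UG] f F)+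
    have "L2norm (\<lambda>x. U t f x - U t (F n) x) = L2norm (\<lambda>x. f x - F n x)" for n
    proof -
      have "L2norm (\<lambda>x. U t f x - U t (F n) x) = L2norm (U t (\<lambda>x. f x - F n x))"
        using unitary_group_diff[OF UG f F(1), of t n] unfolding ae_eq_def
        by (intro L2norm_cong L2_diff unitary_groupD(1)[OF UG] f F) (auto simp: ae_eq_def)
      then show ?thesis using unitary_groupD(4)[OF UG L2_diff[OF f F(1)]] by simp
    qed
    then show "(\<lambda>n. L2norm (\<lambda>x. U t f x - U t (F n) x)) \<longlonglongrightarrow> 0"
      using less_imp_le[OF F(2)] L2norm_nonneg
      by (intro tendsto_sandwich[OF _ _ tendsto_const inv]) (auto intro: always_eventually)
    show "(\<lambda>n. C * (1 + 1 / real (Suc n))) \<longlonglongrightarrow> C"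
      using tendsto_mult[OF tendsto_const tendsto_add[OF tendsto_const inv], of C 1] by simp
  qed (rule F(3))
  then show "Linfnorm w (U t f) \<le> ennreal (2 * (4 * t) powr (- 1/2 + l) * B)"
    unfolding Linfnorm_def C_def[symmetric] using L2D(1)[OF unitary_groupD(1)[OF UG f, of t]] C
    by (intro esssup_I) (auto intro: ennreal_leI elim!: eventually_mono)
qed

section \<open>Dispersive estimates\<close>

text \<open>Since x y = 2 t z, the factor (x y)^(-l) is z^(-l) (2 t)^(-l). The first power cancels
  the z^l of the Bessel bound, the second cancels the t^l in the prefactor.\<close>

lemma dispersive_bound_nonpos:
  assumes l: "l \<in> {-1/2<..0}" and U: "is_exp_group (H_graph l (pi / 2)) U"
  shows "\<exists>C>0. \<forall>t>0. norm_L1_Linf (\<lambda>x. 1) (\<lambda>x. 1) (U t) \<le> ennreal (C * \<bar>t\<bar> powr (- 1/2))"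
proof -
  have l': "l \<in> {-1/2<..<1/2}" using l by auto
  obtain M where M: "M > 0" "\<And>z. 0 \<le> z \<Longrightarrow> z \<le> 1 \<Longrightarrow> \<bar>bessel l z\<bar> \<le> M"
    "\<And>z. 1 \<le> z \<Longrightarrow> \<bar>bessel l z\<bar> \<le> M * z powr l"
    using bessel_bound[OF l'] by blast
  define C where "C = 2 * 4 powr (- 1/2 + l) * M * 2 powr (- l)"
  have "norm_L1_Linf (\<lambda>x. 1) (\<lambda>x. 1) (U t) \<le> ennreal (C * \<bar>t\<bar> powr (- 1/2))" if t: "t > 0" for t
  proof -
    have "norm_L1_Linf (\<lambda>x. 1) (\<lambda>x. 1) (U t) \<le> ennreal (2 * (4 * t) powr (- 1/2 + l) * (M * (2 * t) powr (- l)))"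
    proof (rule dispersive_bound[OF l' U t])
      show "integrable half_line (\<lambda>x. x powr (- l) * exp (- x\<^sup>2) * 1)"
        using gaussian_moment_integrable[of "- l" 1] l by simp
      fix x y :: real assume xy: "x > 0" "y > 0"
      define z where "z = x / (2 * t) * y"
      have z: "z > 0" using xy t by (simp add: z_def)
      have b: "\<bar>bessel l z\<bar> \<le> M * z powr l"
      proof (cases "z \<le> 1")
        case True
        have "1 \<le> z powr l" using powr_mono'[of l 0 z] True z l by simp
        then have "M * 1 \<le> M * z powr l" using M(1) by (intro mult_left_mono) auto
        then show ?thesis using M(2)[of z] True z by simp
      qed (use M(3) in simp)
      have "x * y = z * (2 * t)" using t by (simp add: z_def)
      then have "x powr (- l) * y powr (- l) = z powr (- l) * (2 * t) powr (- l)"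
        using xy t z by (metis less_imp_le powr_mult zero_less_mult_iff zero_less_numeral)
      then have "x powr (- l) * y powr (- l) * \<bar>bessel l z\<bar> \<le> z powr (- l) * (2 * t) powr (- l) * (M * z powr l)"
        using b by (simp add: mult_left_mono)
      also have "\<dots> = M * (2 * t) powr (- l) * (z powr (- l) * z powr l)" by simp
      also have "z powr (- l) * z powr l = 1" using z by (simp flip: powr_add)
      finally show "x powr (- l) * y powr (- l) * \<bar>bessel l (x / (2 * t) * y)\<bar> * 1 \<le> M * (2 * t) powr (- l) * 1"
        by (simp add: z_def)
    qed (use M(1) t in auto)
    also have "2 * (4 * t) powr (- 1/2 + l) * (M * (2 * t) powr (- l)) = C * (t powr (- 1/2 + l) * t powr (- l))"
      unfolding C_def using t by (simp add: powr_mult)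
    also have "t powr (- 1/2 + l) * t powr (- l) = \<bar>t\<bar> powr (- 1/2)" using t by (simp flip: powr_add)
    finally show ?thesis .
  qed
  moreover have "C > 0" using M(1) by (simp add: C_def)
  ultimately show ?thesis by blast
qed

text \<open>For z \<le> 1 the Bessel factor is only bounded, so the two weights absorb x^(-l) and
  y^(-l) separately and no power of t is gained. For z > 1 the computation with x y = 2 t z even
  leaves a spare factor (2 t)^(-l).\<close>

lemma dispersive_bound_pos:
  assumes l: "l \<in> {0<..<1/2}" and U: "is_exp_group (H_graph l (pi / 2)) U"
  shows "\<exists>C>0. \<forall>t\<ge>1. norm_L1_Linf (\<lambda>x. max (x powr (- l)) 1) (\<lambda>x. min (x powr l) 1) (U t)
                \<le> ennreal (C * \<bar>t\<bar> powr (- 1/2 + l))"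
proof -
  have l': "l \<in> {-1/2<..<1/2}" using l by auto
  obtain M where M: "M > 0" "\<And>z. 0 \<le> z \<Longrightarrow> z \<le> 1 \<Longrightarrow> \<bar>bessel l z\<bar> \<le> M"
    "\<And>z. 1 \<le> z \<Longrightarrow> \<bar>bessel l z\<bar> \<le> M * z powr l"
    using bessel_bound[OF l'] by blast
  define C where "C = 2 * 4 powr (- 1/2 + l) * M"
  have "norm_L1_Linf (\<lambda>x. max (x powr (- l)) 1) (\<lambda>x. min (x powr l) 1) (U t) \<le> ennreal (C * \<bar>t\<bar> powr (- 1/2 + l))"
    if t1: "t \<ge> 1" for t
  proof -
    have t: "t > 0" using t1 by simp
    have "norm_L1_Linf (\<lambda>x. max (x powr (- l)) 1) (\<lambda>x. min (x powr l) 1) (U t) \<le> ennreal (2 * (4 * t) powr (- 1/2 + l) * M)"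
    proof (rule dispersive_bound[OF l' U t])
      have "integrable half_line (\<lambda>x. x powr (- 2 * l) * exp (- 1 * x\<^sup>2) + x powr (- l) * exp (- 1 * x\<^sup>2))"
        using l by (intro Bochner_Integration.integrable_add gaussian_moment_integrable) auto
      then show "integrable half_line (\<lambda>x. x powr (- l) * exp (- x\<^sup>2) * max (x powr (- l)) 1)"
      proof (rule Bochner_Integration.integrable_bound)
        have "x powr (- l) * exp (- x\<^sup>2) * max (x powr (- l)) 1 \<le>
            x powr (- 2 * l) * exp (- 1 * x\<^sup>2) + x powr (- l) * exp (- 1 * x\<^sup>2)" for x :: real
        proof -
          have "x powr (- l) * exp (- x\<^sup>2) * max (x powr (- l)) 1 \<le> x powr (- l) * exp (- x\<^sup>2) * (x powr (- l) + 1)"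
            by (intro mult_left_mono) auto
          moreover have "x powr (- 2 * l) = x powr (- l) * x powr (- l)" by (simp flip: powr_add)
          ultimately show ?thesis by (simp add: algebra_simps)
        qed
        then show "AE x in half_line. norm (x powr (- l) * exp (- x\<^sup>2) * max (x powr (- l)) 1) \<le>
            norm (x powr (- 2 * l) * exp (- 1 * x\<^sup>2) + x powr (- l) * exp (- 1 * x\<^sup>2))"
          by (intro AE_I2) (simp add: abs_mult)
      qed measurable
      fix x y :: real assume xy: "x > 0" "y > 0"
      define z where "z = x / (2 * t) * y"
      define m where "m = min (x powr l) 1"
      have z: "z > 0" using xy t by (simp add: z_def)
      have m: "0 \<le> m" "m \<le> 1" "x powr (- l) * m \<le> 1"
      proof -
        have "x powr (- l) * m \<le> x powr (- l) * x powr l" unfolding m_def by (intro mult_left_mono) auto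
        also have "\<dots> = 1" using xy by (simp flip: powr_add)
        finally show "x powr (- l) * m \<le> 1" .
      qed (auto simp: m_def)
      show "x powr (- l) * y powr (- l) * \<bar>bessel l (x / (2 * t) * y)\<bar> * min (x powr l) 1 \<le> M * max (y powr (- l)) 1"
      proof (cases "z \<le> 1")
        case True
        have "(x powr (- l) * m) * (y powr (- l)) * \<bar>bessel l z\<bar> \<le> 1 * max (y powr (- l)) 1 * M"
          using m M(1) M(2)[of z] True z by (intro mult_mono) auto
        then show ?thesis by (simp add: z_def m_def mult_ac)
      next
        case False
        have "x * y = z * (2 * t)" using t by (simp add: z_def)
        then have xyz: "x powr (- l) * y powr (- l) = z powr (- l) * (2 * t) powr (- l)"
          using xy t z by (metis less_imp_le powr_mult zero_less_mult_iff zero_less_numeral)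
        \<comment> \<open>The restriction to t \<ge> 1 enters here: the spare factor blows up as t
          tends to 0.\<close>
        have "(2 * t) powr (- l) \<le> 1" using powr_mono[of "- l" 0 "2 * t"] t1 l by simp
        have "x powr (- l) * y powr (- l) * \<bar>bessel l z\<bar> * m \<le> z powr (- l) * (2 * t) powr (- l) * (M * z powr l) * 1"
          unfolding xyz using M(1) M(3)[of z] False m by (intro mult_mono) auto
        also have "\<dots> = M * (2 * t) powr (- l) * (z powr (- l) * z powr l)" by simp
        also have "z powr (- l) * z powr l = 1" using z by (simp flip: powr_add)
        also have "M * (2 * t) powr (- l) * 1 \<le> M * max (y powr (- l)) 1"
          using M(1) \<open>(2 * t) powr (- l) \<le> 1\<close> by (simp add: mult_left_mono le_max_iff_disj)
        finally show ?thesis by (simp add: z_def m_def)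
      qed
    qed (use M(1) in \<open>auto simp: le_max_iff_disj\<close>)
    also have "2 * (4 * t) powr (- 1/2 + l) * M = C * \<bar>t\<bar> powr (- 1/2 + l)"
      unfolding C_def using t by (simp add: powr_mult)
    finally show ?thesis .
  qed
  moreover have "C > 0" using M(1) by (simp add: C_def)
  ultimately show ?thesis by blast
qed

theorem theorem1p1:
  fixes l :: real
    and U :: "real \<Rightarrow> (real \<Rightarrow> complex) \<Rightarrow> (real \<Rightarrow> complex)"
  assumes "l \<in> {-1/2<..<1/2}"
    and "is_exp_group (H_graph l (pi / 2)) U"
  shows "(l \<in> {-1/2<..0} \<longrightarrow>
           (\<exists>C>0. \<forall>\<^sub>F t in at_top.
              norm_L1_Linf (\<lambda>x. 1) (\<lambda>x. 1) (U t) \<le> ennreal (C * \<bar>t\<bar> powr (- 1/2)))) \<and>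
         (l \<in> {0<..<1/2} \<longrightarrow>
           (\<exists>C>0. \<forall>\<^sub>F t in at_top.
              norm_L1_Linf (\<lambda>x. max (x powr (- l)) 1) (\<lambda>x. min (x powr l) 1) (U t)
                \<le> ennreal (C * \<bar>t\<bar> powr (- 1/2 + l))) \<and>
           (\<exists>c>0. \<exists>t0>0. \<forall>t\<ge>t0.
              ennreal (c * \<bar>t\<bar> powr (- 1/2 + l))
                \<le> norm_L1_Linf (\<lambda>x. max (x powr (- l)) 1) (\<lambda>x. min (x powr l) 1) (U t)))"
proof (intro conjI impI)
  assume "l \<in> {-1/2<..0}"
  from dispersive_bound_nonpos[OF this assms(2)] obtain C where
    C: "C > 0" "\<forall>t>0. norm_L1_Linf (\<lambda>x. 1) (\<lambda>x. 1) (U t) \<le> ennreal (C * \<bar>t\<bar> powr (- 1/2))" by blast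
  then show "\<exists>C>0. \<forall>\<^sub>F t in at_top. norm_L1_Linf (\<lambda>x. 1) (\<lambda>x. 1) (U t) \<le> ennreal (C * \<bar>t\<bar> powr (- 1/2))"
    by (intro exI[of _ C] conjI eventually_mono[OF eventually_gt_at_top[of 0]]) auto
next
  assume l: "l \<in> {0<..<1/2}"
  from dispersive_bound_pos[OF this assms(2)] obtain C where
    C: "C > 0" "\<forall>t\<ge>1. norm_L1_Linf (\<lambda>x. max (x powr (- l)) 1) (\<lambda>x. min (x powr l) 1) (U t)
                \<le> ennreal (C * \<bar>t\<bar> powr (- 1/2 + l))" by blast
  then show "\<exists>C>0. \<forall>\<^sub>F t in at_top. norm_L1_Linf (\<lambda>x. max (x powr (- l)) 1) (\<lambda>x. min (x powr l) 1) (U t)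
                \<le> ennreal (C * \<bar>t\<bar> powr (- 1/2 + l))"
    by (intro exI[of _ C] conjI eventually_mono[OF eventually_ge_at_top[of 1]]) auto
  show "\<exists>c>0. \<exists>t0>0. \<forall>t\<ge>t0. ennreal (c * \<bar>t\<bar> powr (- 1/2 + l))
                \<le> norm_L1_Linf (\<lambda>x. max (x powr (- l)) 1) (\<lambda>x. min (x powr l) 1) (U t)"
    by (rule dispersive_lower_bound[OF l assms(2)])
qed

end
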